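(* Let $\gamma:\{1,2,\dots\}\to[0,\infty)$ with $\gamma(1)=0$, and for a constant $\Delta$ let $g(0)=0$ and $g(k)=\Delta+\gamma(k)$ for $k\ge 1$, where $g$ is an admissible gap penalty (nonnegative, nondecreasing and concave, as specified in the context; $\Delta$ ranges over the values for which this is so). Let $\theta_*$ be the unique positive solution of $E\exp[\theta K(x_1,y_1)]=1$. (a) If $\sum_{k=1}^{\infty}\exp[-\widehat{\theta}\gamma(k)]<\infty$ for some $\widehat{\theta}<\theta_*$, then $g$ lies in the logarithmic domain for all large $\Delta$ (that is, there is $\Delta_0$ such that this holds for all $\Delta\ge\Delta_0$). (b) If $\sum_{k=1}^{\infty}\exp[-\widehat{\theta}\gamma(k)]=\infty$ for some $\widehat{\theta}>\theta_*$, then $g$ lies in the linear domain for all $\Delta$. (c) Let $\gamma(k)=\delta\log k$ for some $\delta>0$. If $\delta>\theta_*^{-1}$, then $g$ lies in the logarithmic domain for all large $\Delta$. Conversely, if $\delta<\theta_*^{-1}$, then $g$ lies in the linear domain for all $\Delta$.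
   Context: Setting. $\mathcal{A}$ is a finite alphabet, $K:\mathcal{A}\times\mathcal{A}\to\mathbf{R}$ is a symmetric score matrix, $K(a,b)=K(b,a)$. The letters $x_1,x_2,\dots$ and $y_1,y_2,\dots$ are all independent and identically distributed with law $\mu$ on $\mathcal{A}$, $\mu(a)>0$ for all $a\in\mathcal{A}$. It is assumed that $E[K(x_1,y_1)]<0$ and $K_{\max}:=\max_{a,b\in\mathcal{A}}K(a,b)>0$. Write $\mathbf{x}_m=x_1\cdots x_m$, $\mathbf{y}_n=y_1\cdots y_n$. Gap penalty. $g:\{0,1,\dots\}\to[0,\infty)$ is nondecreasing with $g(0)=0$ and concave, i.e. $g(k+1)-g(k)\le g(k)-g(k-1)$ for all $k\ge1$. (For $g(k)=\Delta+\gamma(k)$, $k\geq 1$, with $\gamma(1)=0$, this means: $\gamma$ is nondecreasing and concave on $\{1,2,\dots\}$ and $\Delta\ge\gamma(2)$.) Alignments and scores. $\mathcal{Z}$ is the class of all nonempty candidate alignments $\mathbf{z}=\{(i(t),j(t)):1\le t\le u\}$, $u\ge1$, where $i(1)<\cdots<i(u)$ and $j(1)<\cdots<j(u)$ are positive integers. If $i(u)\le m$ and $j(u)\le n$, $$S_{\mathbf{z}}(\mathbf{x}_m,\mathbf{y}_n)=\sum_{t=1}^{u}K(x_{i(t)},y_{j(t)})-\sum_{t=1}^{u-1}\bigl[g(i(t+1)-i(t)-1)+g(j(t+1)-j(t)-1)\bigr],$$ $$R_{\mathbf{z}}(\mathbf{x}_m,\mathbf{y}_n)=S_{\mathbf{z}}(\mathbf{x}_m,\mathbf{y}_n)-g(i(1)-1)-g(j(1)-1)-g(m-i(u))-g(n-j(u)),$$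 and both are $-\infty$ if $i(u)>m$ or $j(u)>n$. The local alignment score is $H(\mathbf{x}_m,\mathbf{y}_n)=\sup_{\mathbf{z}\in\mathcal{Z}}S_{\mathbf{z}}(\mathbf{x}_m,\mathbf{y}_n)$ and the global alignment score is $G(\mathbf{x}_m,\mathbf{y}_n)=\sup_{\mathbf{z}\in\mathcal{Z}}R_{\mathbf{z}}(\mathbf{x}_m,\mathbf{y}_n)$. Domains. $g$ lies in the linear domain if $\beta:=\lim_{n\to\infty}E[G(\mathbf{x}_n,\mathbf{y}_n)/n]>0$. $g$ lies in the logarithmic domain if there exist constants $\tau_2>\tau_1>0$ such that $\lim_{n\to\infty}P\{\tau_2>H(\mathbf{x}_n,\mathbf{y}_n)/\log n>\tau_1\}=1$. *)

theory Defs
  imports "HOL-Probability.Probability"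
begin

definition gap_penalty :: "(nat \<Rightarrow> real) \<Rightarrow> bool" where
  "gap_penalty g \<longleftrightarrow>
     g 0 = 0 \<and> (\<forall>k. 0 \<le> g k) \<and> mono g \<and>
     (\<forall>k\<ge>1. g (k + 1) - g k \<le> g k - g (k - 1))"

definition gap :: "real \<Rightarrow> (nat \<Rightarrow> real) \<Rightarrow> nat \<Rightarrow> real" where
  "gap \<Delta> \<gamma> k = (if k = 0 then 0 else \<Delta> + \<gamma> k)"

text \<open>In particular, admissibility is preserved when \<open>\<Delta>\<close> increases.\<close>

lemma gap_penalty_gap_iff:
  assumes "\<gamma> 1 = 0"
  shows "gap_penalty (gap \<Delta> \<gamma>) \<longleftrightarrow>
    (\<forall>k\<ge>1. \<gamma> k \<le> \<gamma> (k + 1)) \<and>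
    (\<forall>k\<ge>2. \<gamma> (k + 1) - \<gamma> k \<le> \<gamma> k - \<gamma> (k - 1)) \<and> \<gamma> 2 \<le> \<Delta>"
  (is "?L \<longleftrightarrow> ?mono \<and> ?conc \<and> ?D")
proof (intro iffI conjI)
  assume ?L
  then have m: "gap \<Delta> \<gamma> k \<le> gap \<Delta> \<gamma> (Suc k)"
    and c: "1 \<le> k \<Longrightarrow> gap \<Delta> \<gamma> (k + 1) - gap \<Delta> \<gamma> k \<le> gap \<Delta> \<gamma> k - gap \<Delta> \<gamma> (k - 1)" for k
    by (auto simp: gap_penalty_def mono_def)
  show ?mono
  proof (intro allI impI)
    fix k :: nat assume "1 \<le> k"
    then show "\<gamma> k \<le> \<gamma> (k + 1)" using m[of k] by (simp add: gap_def)
  qed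
  show ?conc
  proof (intro allI impI)
    fix k :: nat assume "2 \<le> k"
    then show "\<gamma> (k + 1) - \<gamma> k \<le> \<gamma> k - \<gamma> (k - 1)" using c[of k] by (simp add: gap_def)
  qed
  show ?D using c[of 1] assms by (simp add: gap_def numeral_2_eq_2)
next
  assume A: "?mono \<and> ?conc \<and> ?D"
  have "0 \<le> \<gamma> 2" using A assms by (metis one_add_one order_refl)
  then have D: "0 \<le> \<Delta>" using A by linarith
  have m: "mono (gap \<Delta> \<gamma>)"
    unfolding mono_iff_le_Suc
  proof
    fix k show "gap \<Delta> \<gamma> k \<le> gap \<Delta> \<gamma> (Suc k)"
      using A D assms by (cases k) (auto simp: gap_def)
  qed
  have "0 \<le> gap \<Delta> \<gamma> k" for k
    using monoD[OF m, of 0 k] by (simp add: gap_def)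
  moreover have "gap \<Delta> \<gamma> (k + 1) - gap \<Delta> \<gamma> k \<le> gap \<Delta> \<gamma> k - gap \<Delta> \<gamma> (k - 1)"
    if "1 \<le> k" for k
  proof (cases "k = 1")
    case True
    then show ?thesis using A assms by (simp add: gap_def numeral_2_eq_2)
  next
    case False
    then have "2 \<le> k" using that by simp
    then show ?thesis using A by (simp add: gap_def)
  qed
  ultimately show ?L using m by (simp add: gap_penalty_def gap_def)
qed

text \<open>A candidate alignment \<open>{(i(t), j(t)). 1 \<le> t \<le> u}\<close> is the list of its pairs in increasing
  order; the \<open>t\<close>-th pair is \<open>z ! (t - 1)\<close>.\<close>

definition alignments :: "(nat \<times> nat) list set" where
  "alignments = {z. z \<noteq> [] \<and> (\<forall>(i, j)\<in>set z. 1 \<le> i \<and> 1 \<le> j) \<and>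
     sorted_wrt (\<lambda>p q. fst p < fst q \<and> snd p < snd q) z}"

text \<open>The words \<open>x\<^sub>1\<cdots>x\<^sub>m\<close> and \<open>y\<^sub>1\<cdots>y\<^sub>n\<close> are given as sequences together with their lengths; the
  entries at index 0 are never used.  The truncated subtractions below are exact on alignments
  that fit into the words, and the others score \<open>-\<infinity>\<close>.\<close>

definition local_align_score ::
  "('a \<Rightarrow> 'a \<Rightarrow> real) \<Rightarrow> (nat \<Rightarrow> real) \<Rightarrow> (nat \<Rightarrow> 'a) \<Rightarrow> nat \<Rightarrow> (nat \<Rightarrow> 'a) \<Rightarrow> nat
    \<Rightarrow> (nat \<times> nat) list \<Rightarrow> ereal" where
  "local_align_score K g x m y n z =
     (if fst (last z) \<le> m \<and> snd (last z) \<le> n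
      then ereal ((\<Sum>t<length z. K (x (fst (z ! t))) (y (snd (z ! t))))
        - (\<Sum>t<length z - 1. g (fst (z ! Suc t) - fst (z ! t) - 1)
                              + g (snd (z ! Suc t) - snd (z ! t) - 1)))
      else -\<infinity>)"

definition global_align_score ::
  "('a \<Rightarrow> 'a \<Rightarrow> real) \<Rightarrow> (nat \<Rightarrow> real) \<Rightarrow> (nat \<Rightarrow> 'a) \<Rightarrow> nat \<Rightarrow> (nat \<Rightarrow> 'a) \<Rightarrow> nat
    \<Rightarrow> (nat \<times> nat) list \<Rightarrow> ereal" where
  "global_align_score K g x m y n z = local_align_score K g x m y n z
     - ereal (g (fst (hd z) - 1) + g (snd (hd z) - 1)
              + g (m - fst (last z)) + g (n - snd (last z)))"

definition H_score ::
  "('a \<Rightarrow> 'a \<Rightarrow> real) \<Rightarrow> (nat \<Rightarrow> real) \<Rightarrow> (nat \<Rightarrow> 'a) \<Rightarrow> nat \<Rightarrow> (nat \<Rightarrow> 'a) \<Rightarrow> nat \<Rightarrow> ereal" where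
  "H_score K g x m y n = (SUP z\<in>alignments. local_align_score K g x m y n z)"

definition G_score ::
  "('a \<Rightarrow> 'a \<Rightarrow> real) \<Rightarrow> (nat \<Rightarrow> real) \<Rightarrow> (nat \<Rightarrow> 'a) \<Rightarrow> nat \<Rightarrow> (nat \<Rightarrow> 'a) \<Rightarrow> nat \<Rightarrow> ereal" where
  "G_score K g x m y n = (SUP z\<in>alignments. global_align_score K g x m y n z)"

text \<open>Independence of all letters jointly is independence of one family indexed by a disjoint sum;
  only the letters with index at least 1 are constrained.\<close>

definition iid_letters ::
  "'w measure \<Rightarrow> (nat \<Rightarrow> 'w \<Rightarrow> 'a) \<Rightarrow> (nat \<Rightarrow> 'w \<Rightarrow> 'a) \<Rightarrow> 'a pmf \<Rightarrow> bool" where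
  "iid_letters M X Y \<mu> \<longleftrightarrow>
     prob_space.indep_vars M (\<lambda>_. count_space UNIV) (case_sum X Y) ({1..} <+> {1..}) \<and>
     (\<forall>i\<ge>1. distr M (count_space UNIV) (X i) = measure_pmf \<mu>) \<and>
     (\<forall>j\<ge>1. distr M (count_space UNIV) (Y j) = measure_pmf \<mu>)"

definition theta_star ::
  "'w measure \<Rightarrow> (nat \<Rightarrow> 'w \<Rightarrow> 'a) \<Rightarrow> (nat \<Rightarrow> 'w \<Rightarrow> 'a) \<Rightarrow> ('a \<Rightarrow> 'a \<Rightarrow> real) \<Rightarrow> real" where
  "theta_star M X Y K = (THE \<theta>. 0 < \<theta> \<and> (\<integral>\<omega>. exp (\<theta> * K (X 1 \<omega>) (Y 1 \<omega>)) \<partial>M) = 1)"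

text \<open>For \<open>n \<ge> 1\<close> some alignment fits, so the scores are finite and \<^const>\<open>real_of_ereal\<close> does not
  alter them; the value at \<open>n = 0\<close> does not affect the limit.\<close>

definition linear_domain ::
  "'w measure \<Rightarrow> (nat \<Rightarrow> 'w \<Rightarrow> 'a) \<Rightarrow> (nat \<Rightarrow> 'w \<Rightarrow> 'a) \<Rightarrow> ('a \<Rightarrow> 'a \<Rightarrow> real) \<Rightarrow> (nat \<Rightarrow> real)
    \<Rightarrow> bool" where
  "linear_domain M X Y K g \<longleftrightarrow>
     (\<exists>\<beta>>0. (\<lambda>n. \<integral>\<omega>. real_of_ereal (G_score K g (\<lambda>i. X i \<omega>) n (\<lambda>j. Y j \<omega>) n) / real n \<partial>M)
              \<longlonglongrightarrow> \<beta>)"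

definition logarithmic_domain ::
  "'w measure \<Rightarrow> (nat \<Rightarrow> 'w \<Rightarrow> 'a) \<Rightarrow> (nat \<Rightarrow> 'w \<Rightarrow> 'a) \<Rightarrow> ('a \<Rightarrow> 'a \<Rightarrow> real) \<Rightarrow> (nat \<Rightarrow> real)
    \<Rightarrow> bool" where
  "logarithmic_domain M X Y K g \<longleftrightarrow>
     (\<exists>\<tau>1 \<tau>2. 0 < \<tau>1 \<and> \<tau>1 < \<tau>2 \<and>
       (\<lambda>n. measure M {\<omega> \<in> space M.
           \<tau>1 < real_of_ereal (H_score K g (\<lambda>i. X i \<omega>) n (\<lambda>j. Y j \<omega>) n) / ln (real n) \<and>
           real_of_ereal (H_score K g (\<lambda>i. X i \<omega>) n (\<lambda>j. Y j \<omega>) n) / ln (real n) < \<tau>2})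
         \<longlonglongrightarrow> 1)"

end

theory Submission
  imports Defs "HOL-Real_Asymp.Real_Asymp"
begin

text \<open>Write \<open>\<theta>\<close> for the positive root of \<open>E exp (\<theta> K(x,y)) = 1\<close>.

  \<^bold>\<open>Logarithmic domain.\<close>  A fixed alignment with \<open>u\<close> pairs uses \<open>2u\<close> different letters, so for
  \<open>0 < s < \<theta>\<close> the mean of \<open>exp (s S)\<close> is \<open>\<rho>\<^sup>u\<close> times its gap factors, where
  \<open>\<rho> = E exp (s K) < 1\<close>.  Summing over all alignments with a given first pair produces a geometric
  series with ratio \<open>\<rho> A\<^sup>2\<close>, \<open>A = \<Sum>k. exp (- s g(k))\<close>.  If \<open>\<Sum>k. exp (- s \<gamma>(k))\<close> converges, then
  \<open>A\<close> tends to \<open>1\<close> as \<open>\<Delta>\<close> grows, the series converges, and a union bound over the \<open>n\<^sup>2\<close> possible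
  first pairs shows that \<open>H\<close> exceeds \<open>3 log n / s\<close> with probability \<open>O(1/n)\<close>
  (\<open>local_max_tail\<close>, \<open>logarithmic_domainI\<close>).

  \<^bold>\<open>Ungapped matches.\<close>  Both parts rest on one lower bound (\<open>local_max_large\<close>): for every
  \<open>t < 2/\<theta>\<close> the probability that two words of length \<open>n\<close> contain gapless segments scoring at least
  \<open>t log n\<close> tends to \<open>1\<close>.  Each word is cut into \<open>N\<close> blocks of length \<open>L\<close>, and the pairs of blocks
  are weighted by \<open>exp (\<theta> S)\<close>, restricted to pairs that look typical for the tilted letter law
  \<open>\<alpha>(a,b) = \<mu>(a) \<mu>(b) exp (\<theta> K(a,b))\<close>.  The sum of these weights has mean of order \<open>N\<^sup>2\<close>, and a
  second moment estimate shows that it does not vanish once \<open>log N\<close> exceeds both \<open>L \<theta> m / 2\<close> and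
  \<open>L h\<close>, where \<open>m\<close> is the mean score under \<open>\<alpha>\<close> and \<open>h\<close> the relative entropy of a marginal of \<open>\<alpha>\<close>
  with respect to \<open>\<mu>\<close>.  The second condition comes from pairs of block pairs that share a block.
  It follows from the first because \<open>K\<close> is symmetric: both marginals of \<open>\<alpha>\<close> then have entropy
  \<open>h\<close>, and \<open>\<theta> m - 2 h\<close> is the relative entropy of \<open>\<alpha>\<close> with respect to the product of its
  marginals, hence nonnegative (\<open>ent_le\<close>).  A typical pair scores about \<open>L m\<close>, and \<open>L\<close> is about
  \<open>2 log n / (\<theta> m)\<close>.

  \<^bold>\<open>Linear domain.\<close>  If \<open>\<Sum>k. exp (- s \<gamma>(k))\<close> diverges for some \<open>s > \<theta>\<close>, then
  \<open>\<gamma>(k) \<le> c log k\<close> for infinitely many \<open>k\<close>, with some \<open>c < 1/\<theta>\<close>.  For such a large \<open>k\<close>, cut both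
  words into blocks of length \<open>n = k div 2\<close> and join the best local alignments of the consecutive
  blocks.  Each block gains nearly \<open>(2/\<theta>) log n\<close> on average, while joining two blocks costs at most
  \<open>2 g(2n) \<le> 2 \<Delta> + 2 c log k\<close>, which is less.  So the mean global score is positive for many
  blocks (\<open>linear_domainI\<close>).  By concavity \<open>g\<close> is subadditive, so the mean global score is
  superadditive in the length, and its growth rate exists and is at least each of the ratios
  \<open>E G / n\<close> (\<open>superadditive_limit\<close>).

  The third part of the theorem is the case \<open>exp (- s \<gamma>(k)) = k powr (- s \<delta>)\<close>.

  Moments are computed for words drawn from \<open>replicate_pmf\<close>, by recursion on the length, and
  \<open>law_letters\<close> transfers them to the given letters.\<close>


section \<open>Means over words of independent letters\<close>

abbreviation mean :: "'b pmf \<Rightarrow> ('b \<Rightarrow> real) \<Rightarrow> real" where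
  "mean p f \<equiv> measure_pmf.expectation p f"

lemma finite_set_replicate_pmf:
  assumes "finite (set_pmf p)"
  shows "finite (set_pmf (replicate_pmf n p))"
proof -
  have "set_pmf (replicate_pmf n p) = {xs. set xs \<subseteq> set_pmf p \<and> length xs = n}"
    by (auto simp: set_replicate_pmf)
  then show ?thesis using finite_lists_length_eq[OF assms] by simp
qed

lemma length_replicate_pmf: "xs \<in> set_pmf (replicate_pmf n p) \<Longrightarrow> length xs = n"
  by (simp add: set_replicate_pmf)

lemma mean_bind:
  assumes "finite (set_pmf p)" "\<And>x. x \<in> set_pmf p \<Longrightarrow> finite (set_pmf (q x))"
  shows "mean (bind_pmf p q) f = mean p (\<lambda>x. mean (q x) f)"
  using assms
  by (subst pmf_expectation_bind[of "set_pmf p"])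
     (auto simp: integral_measure_pmf_real[of "set_pmf p"] mult.commute)

lemma mean_cong:
  assumes "\<And>x. x \<in> set_pmf p \<Longrightarrow> f x = g x"
  shows "mean p f = mean p g"
  by (rule integral_cong_AE) (auto simp: AE_measure_pmf_iff assms)

lemma mean_mono:
  assumes "finite (set_pmf p)" "\<And>x. x \<in> set_pmf p \<Longrightarrow> f x \<le> g x"
  shows "mean p f \<le> mean p g"
  by (rule integral_mono_AE) (auto simp: AE_measure_pmf_iff assms integrable_measure_pmf_finite)

lemma mean_add:
  assumes "finite (set_pmf p)"
  shows "mean p (\<lambda>x. f x + g x) = mean p f + mean p g"
  using assms by (simp add: integrable_measure_pmf_finite)

lemma mean_diff:
  assumes "finite (set_pmf p)"
  shows "mean p (\<lambda>x. f x - g x) = mean p f - mean p g"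
  using assms by (simp add: integrable_measure_pmf_finite)

lemma mean_swap:
  assumes "finite (set_pmf p)" "finite (set_pmf q)"
  shows "mean p (\<lambda>x. mean q (f x)) = mean q (\<lambda>y. mean p (\<lambda>x. f x y))"
  using assms
  by (simp add: integral_measure_pmf_real[of "set_pmf p"] integral_measure_pmf_real[of "set_pmf q"]
      sum_distrib_right sum_distrib_left mult.assoc mult.left_commute sum.swap[of _ "set_pmf p"])
     (simp add: mult_ac)

lemma mean_pair:
  assumes "finite (set_pmf p)" "finite (set_pmf q)"
  shows "mean (pair_pmf p q) f = mean p (\<lambda>x. mean q (\<lambda>y. f (x, y)))"
  unfolding pair_pmf_def using assms by (simp add: mean_bind)

lemma mean_replicate_Suc:
  assumes "finite (set_pmf p)"
  shows "mean (replicate_pmf (Suc n) p) f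
    = mean p (\<lambda>x. mean (replicate_pmf n p) (\<lambda>xs. f (x # xs)))"
  using assms finite_set_replicate_pmf[OF assms, of n] by (simp add: mean_bind)

lemma mean_replicate_add:
  assumes "finite (set_pmf p)"
  shows "mean (replicate_pmf (m + n) p) f
    = mean (replicate_pmf m p) (\<lambda>xs. mean (replicate_pmf n p) (\<lambda>ys. f (xs @ ys)))"
  unfolding replicate_pmf_distrib
  using finite_set_replicate_pmf[OF assms] by (simp add: mean_bind)

lemma mean_replicate_concat:
  assumes "finite (set_pmf p)"
  shows "mean (replicate_pmf (N * L) p) f
    = mean (replicate_pmf N (replicate_pmf L p)) (\<lambda>ws. f (concat ws))"
proof (induction N arbitrary: f)
  case (Suc N)
  show ?case
    unfolding mult_Suc mean_replicate_add[OF assms]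
    by (subst mean_replicate_Suc[OF finite_set_replicate_pmf[OF assms]]) (simp only: Suc, simp)
qed simp

text \<open>Two independent words of equal length are one word of independent pairs; this turns an ungapped
  score into a sum of independent terms.\<close>
lemma mean_replicate_zip:
  assumes "finite (set_pmf p)" "finite (set_pmf q)"
  shows "mean (replicate_pmf n p) (\<lambda>xs. mean (replicate_pmf n q) (\<lambda>ys. f (zip xs ys)))
    = mean (replicate_pmf n (pair_pmf p q)) f"
proof (induction n arbitrary: f)
  case (Suc n)
  have fin: "finite (set_pmf (pair_pmf p q))" using assms by simp
  have "mean (replicate_pmf (Suc n) p) (\<lambda>xs. mean (replicate_pmf (Suc n) q) (\<lambda>ys. f (zip xs ys)))
    = mean p (\<lambda>x. mean (replicate_pmf n p) (\<lambda>xs. mean q (\<lambda>y.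
        mean (replicate_pmf n q) (\<lambda>ys. f ((x, y) # zip xs ys)))))"
    by (simp only: mean_replicate_Suc[OF assms(1)] mean_replicate_Suc[OF assms(2)] zip_Cons_Cons)
  also have "\<dots> = mean p (\<lambda>x. mean q (\<lambda>y. mean (replicate_pmf n p) (\<lambda>xs.
        mean (replicate_pmf n q) (\<lambda>ys. f ((x, y) # zip xs ys)))))"
    by (subst mean_swap[OF finite_set_replicate_pmf[OF assms(1)] assms(2)]) simp
  also have "\<dots> = mean (replicate_pmf (Suc n) (pair_pmf p q)) f"
    unfolding mean_replicate_Suc[OF fin] mean_pair[OF assms]
    using Suc[of "\<lambda>xs. f (_ # xs)"] by simp
  finally show ?case .
qed simp

lemma mean_replicate_prod:
  assumes "finite (set_pmf p)"
  shows "mean (replicate_pmf n p) (\<lambda>xs. \<Prod>x\<leftarrow>xs. f x) = mean p f ^ n"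
proof (induction n)
  case (Suc n)
  then show ?case by (simp only: mean_replicate_Suc[OF assms]) simp
qed simp

lemma mean_const: "mean p (\<lambda>x. c) = c"
  by simp

text \<open>The mean square is the variance plus the squared bias, and the variance is at most \<open>n\<close> times the
  second moment of one term.  The centre \<open>c\<close> is arbitrary so that the induction can absorb the first
  letter into it, and so that the bound can be used with \<open>c = 0\<close>.\<close>
lemma mean_square_replicate_le:
  assumes fin: "finite (set_pmf p)"
  shows "mean (replicate_pmf n p) (\<lambda>xs. ((\<Sum>x\<leftarrow>xs. f x) - c)\<^sup>2)
    \<le> real n * mean p (\<lambda>x. (f x)\<^sup>2) + (real n * mean p f - c)\<^sup>2"
proof (induction n arbitrary: c)
  case (Suc n)
  let ?d = "real n * mean p f - c"
  have "mean (replicate_pmf (Suc n) p) (\<lambda>xs. ((\<Sum>x\<leftarrow>xs. f x) - c)\<^sup>2)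
    = mean p (\<lambda>x. mean (replicate_pmf n p) (\<lambda>xs. ((\<Sum>x\<leftarrow>xs. f x) - (c - f x))\<^sup>2))"
    unfolding mean_replicate_Suc[OF fin] by (simp add: algebra_simps)
  also have "\<dots> \<le> mean p (\<lambda>x. real n * mean p (\<lambda>x. (f x)\<^sup>2) + (?d + f x)\<^sup>2)"
    by (rule mean_mono[OF fin]) (use Suc[of "c - f _"] in \<open>simp add: algebra_simps\<close>)
  also have "\<dots> = mean p (\<lambda>x. (real n * mean p (\<lambda>x. (f x)\<^sup>2) + ?d\<^sup>2) + (2 * ?d * f x + (f x)\<^sup>2))"
    by (rule mean_cong) (simp add: power2_eq_square algebra_simps)
  also have "\<dots> = real n * mean p (\<lambda>x. (f x)\<^sup>2) + ?d\<^sup>2 + (2 * ?d * mean p f + mean p (\<lambda>x. (f x)\<^sup>2))"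
    by (simp only: mean_add[OF fin] mean_const integral_mult_right_zero)
  also have "\<dots> \<le> real (Suc n) * mean p (\<lambda>x. (f x)\<^sup>2) + (real (Suc n) * mean p f - c)\<^sup>2"
    by (simp add: power2_eq_square algebra_simps)
  finally show ?case .
qed simp

lemma mean_markov:
  assumes "finite (set_pmf p)" "\<And>x. x \<in> set_pmf p \<Longrightarrow> 0 \<le> f x"
    "\<And>x. x \<in> set_pmf p \<Longrightarrow> P x \<Longrightarrow> b \<le> f x" "0 < b"
  shows "mean p (\<lambda>x. of_bool (P x)) \<le> mean p f / b"
proof -
  have "mean p (\<lambda>x. of_bool (P x)) \<le> mean p (\<lambda>x. f x / b)"
    by (rule mean_mono[OF assms(1)]) (use assms in auto)
  then show ?thesis by simp
qed

lemma weak_law_replicate: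
  assumes fin: "finite (set_pmf p)" and "0 < e" "0 < n"
  shows "mean (replicate_pmf n p) (\<lambda>xs. of_bool (e * real n < \<bar>(\<Sum>x\<leftarrow>xs. f x) - real n * mean p f\<bar>))
    \<le> mean p (\<lambda>x. (f x)\<^sup>2) / (e\<^sup>2 * real n)"
proof -
  have "mean (replicate_pmf n p) (\<lambda>xs. of_bool (e * real n < \<bar>(\<Sum>x\<leftarrow>xs. f x) - real n * mean p f\<bar>))
    \<le> mean (replicate_pmf n p) (\<lambda>xs. ((\<Sum>x\<leftarrow>xs. f x) - real n * mean p f)\<^sup>2) / (e * real n)\<^sup>2"
  proof (rule mean_markov[OF finite_set_replicate_pmf[OF fin]])
    fix xs assume "e * real n < \<bar>(\<Sum>x\<leftarrow>xs. f x) - real n * mean p f\<bar>"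
    then have "(e * real n)\<^sup>2 \<le> \<bar>(\<Sum>x\<leftarrow>xs. f x) - real n * mean p f\<bar>\<^sup>2"
      using assms by (intro power_mono) auto
    then show "(e * real n)\<^sup>2 \<le> ((\<Sum>x\<leftarrow>xs. f x) - real n * mean p f)\<^sup>2" by simp
  qed (use assms in auto)
  also have "\<dots> \<le> (real n * mean p (\<lambda>x. (f x)\<^sup>2)) / (e * real n)\<^sup>2"
    using mean_square_replicate_le[OF fin, of n f "real n * mean p f"]
    by (intro divide_right_mono) auto
  also have "\<dots> = mean p (\<lambda>x. (f x)\<^sup>2) / (e\<^sup>2 * real n)"
    using assms by (simp add: power2_eq_square)
  finally show ?thesis .
qed

text \<open>The weights \<open>w u v\<close> of the \<open>N\<^sup>2\<close> pairs are dependent when they share a word, so Chebyshev's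
  inequality for their sum needs, besides the second moment of \<open>w\<close> itself, the correlations
  \<open>r\<close> of two weights with a common first or second word.  Conditioning on the first words reduces
  everything to sums of independent terms.\<close>
lemma second_moment_pairs:
  fixes w :: "'b \<Rightarrow> 'b \<Rightarrow> real"
  assumes fin: "finite (set_pmf p)"
    and nonneg: "\<And>u v. 0 \<le> w u v"
    and q: "mean p (\<lambda>u. mean p (w u)) = q" "0 < q"
    and s: "mean p (\<lambda>u. mean p (\<lambda>v. (w u v)\<^sup>2)) \<le> s"
    and r1: "mean p (\<lambda>u. (mean p (w u))\<^sup>2) \<le> r"
    and r2: "mean p (\<lambda>v. (mean p (\<lambda>u. w u v))\<^sup>2) \<le> r"
    and N: "0 < N"
  shows "mean (replicate_pmf N p) (\<lambda>us. mean (replicate_pmf N p)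
      (\<lambda>vs. of_bool (\<forall>u\<in>set us. \<forall>v\<in>set vs. w u v = 0)))
    \<le> (s / (real N)\<^sup>2 + 2 * r / real N) / q\<^sup>2"
proof -
  let ?R = "replicate_pmf N p"
  note finR = finite_set_replicate_pmf[OF fin, of N]
  define c where "c = (real N)\<^sup>2 * q"
  have c: "0 < c" using q N by (simp add: c_def)
  define W where "W us vs = (\<Sum>v\<leftarrow>vs. \<Sum>u\<leftarrow>us. w u v)" for us vs
  have "mean ?R (\<lambda>us. mean ?R (\<lambda>vs. of_bool (\<forall>u\<in>set us. \<forall>v\<in>set vs. w u v = 0)))
    \<le> mean ?R (\<lambda>us. mean ?R (\<lambda>vs. (W us vs - c)\<^sup>2) / c\<^sup>2)"
  proof (intro mean_mono[OF finR] mean_markov[OF finR])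
    fix us vs assume "\<forall>u\<in>set us. \<forall>v\<in>set vs. w u v = 0"
    then have "W us vs = (\<Sum>v\<leftarrow>vs. \<Sum>u\<leftarrow>us. 0)"
      unfolding W_def by (intro arg_cong[of _ _ sum_list] map_cong refl) auto
    then have "W us vs = 0" by simp
    then show "c\<^sup>2 \<le> (W us vs - c)\<^sup>2" by simp
  qed (use c in auto)
  also have "\<dots> = mean ?R (\<lambda>us. mean ?R (\<lambda>vs. (W us vs - c)\<^sup>2)) / c\<^sup>2"
    by simp
  also have "\<dots> \<le> ((real N)\<^sup>2 * s + 2 * (real N)^3 * r) / c\<^sup>2"
  proof (rule divide_right_mono)
    \<comment> \<open>Given \<open>us\<close> the sum runs over independent \<open>v\<close>; its conditional mean is then a sum over
        independent \<open>u\<close>, and so is, for fixed \<open>v\<close>, the term whose square has to be averaged.\<close>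
    have lin: "mean p (\<lambda>v. \<Sum>u\<leftarrow>us. w u v) = (\<Sum>u\<leftarrow>us. mean p (w u))" for us
      by (induction us) (simp_all add: mean_add[OF fin])
    have "mean ?R (\<lambda>us. mean ?R (\<lambda>vs. (W us vs - c)\<^sup>2))
      \<le> mean ?R (\<lambda>us. real N * mean p (\<lambda>v. (\<Sum>u\<leftarrow>us. w u v)\<^sup>2)
            + (real N * (\<Sum>u\<leftarrow>us. mean p (w u)) - c)\<^sup>2)"
      unfolding W_def lin[symmetric]
      by (intro mean_mono[OF finR] mean_square_replicate_le[OF fin])
    also have "\<dots> = mean ?R (\<lambda>us. real N * mean p (\<lambda>v. (\<Sum>u\<leftarrow>us. w u v)\<^sup>2)
            + (real N)\<^sup>2 * ((\<Sum>u\<leftarrow>us. mean p (w u)) - real N * q)\<^sup>2)"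
      by (rule mean_cong) (simp add: c_def power2_eq_square algebra_simps)
    also have "\<dots> = real N * mean p (\<lambda>v. mean ?R (\<lambda>us. ((\<Sum>u\<leftarrow>us. w u v) - 0)\<^sup>2))
            + (real N)\<^sup>2 * mean ?R (\<lambda>us. ((\<Sum>u\<leftarrow>us. mean p (w u)) - real N * q)\<^sup>2)"
      by (simp add: mean_add[OF finR] mean_swap[OF fin finR])
    also have "\<dots> \<le> real N * mean p (\<lambda>v. real N * mean p (\<lambda>u. (w u v)\<^sup>2)
              + (real N * mean p (\<lambda>u. w u v) - 0)\<^sup>2)
            + (real N)\<^sup>2 * (real N * mean p (\<lambda>u. (mean p (w u))\<^sup>2)
              + (real N * mean p (\<lambda>u. mean p (w u)) - real N * q)\<^sup>2)"
      by (intro add_mono mult_left_mono mean_mono[OF fin] mean_square_replicate_le[OF fin]) auto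
    also have "\<dots> = (real N)\<^sup>2 * mean p (\<lambda>u. mean p (\<lambda>v. (w u v)\<^sup>2))
            + (real N)^3 * mean p (\<lambda>v. (mean p (\<lambda>u. w u v))\<^sup>2)
            + (real N)^3 * mean p (\<lambda>u. (mean p (w u))\<^sup>2)"
      unfolding q(1) mean_swap[OF fin fin, of "\<lambda>u v. (w u v)\<^sup>2"]
      by (simp add: mean_add[OF fin] power_mult_distrib)
         (simp add: algebra_simps power2_eq_square power3_eq_cube)
    also have "\<dots> \<le> (real N)\<^sup>2 * s + (real N)^3 * r + (real N)^3 * r"
      by (intro add_mono mult_left_mono s r1 r2) auto
    finally show "mean ?R (\<lambda>us. mean ?R (\<lambda>vs. (W us vs - c)\<^sup>2)) \<le> (real N)\<^sup>2 * s + 2 * (real N)^3 * r"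
      by (simp add: algebra_simps)
  qed simp
  also have "\<dots> = (s / (real N)\<^sup>2 + 2 * r / real N) / q\<^sup>2"
    using N q(2) by (simp add: c_def field_simps power2_eq_square power3_eq_cube)
  finally show ?thesis .
qed

section \<open>The exponential tilt of a score\<close>

lemma one_plus_less_exp: "1 + x < exp x" if "x \<noteq> 0" for x :: real
proof -
  have "exp x \<noteq> 1 + x"
  proof (cases "1 + x / 2 \<ge> 0")
    case True
    have "(1 + x / 2)\<^sup>2 \<le> (exp (x / 2))\<^sup>2" using True by (intro power_mono exp_ge_add_one_self)
    also have "\<dots> = exp x" by (simp add: power2_eq_square flip: exp_add)
    finally have "1 + x + (x / 2)\<^sup>2 \<le> exp x" by (simp add: power2_eq_square algebra_simps)
    moreover have "0 < (x / 2)\<^sup>2" using that by simp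
    ultimately show ?thesis by linarith
  next
    case False
    then have "1 + x < 0" by simp
    then show ?thesis using exp_gt_zero[of x] by linarith
  qed
  then show ?thesis using exp_ge_add_one_self[of x] by linarith
qed

text \<open>Strict convexity between \<open>0\<close> and \<open>t\<close>, from the tangent to \<open>exp\<close> at \<open>s * k\<close>.\<close>
lemma exp_strict_convex:
  fixes s t k :: real
  assumes "0 < s" "s < t" "k \<noteq> 0"
  shows "exp (s * k) < 1 - s / t + s / t * exp (t * k)"
proof -
  have "exp (s * k) * (1 + (t - s) * k) < exp (s * k) * exp ((t - s) * k)"
    using one_plus_less_exp[of "(t - s) * k"] assms by simp
  also have "\<dots> = exp (t * k)" by (simp add: algebra_simps flip: exp_add)
  finally have 1: "s / t * (exp (s * k) * (1 + (t - s) * k)) < s / t * exp (t * k)"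
    using assms by (intro mult_strict_left_mono) auto
  have "exp (s * k) * (1 + - s * k) \<le> exp (s * k) * exp (- s * k)"
    by (intro mult_left_mono exp_ge_add_one_self) auto
  then have "exp (s * k) * (1 - s * k) \<le> 1" by (simp flip: exp_add)
  then have 2: "(1 - s / t) * (exp (s * k) * (1 - s * k)) \<le> 1 - s / t"
    using assms mult_left_mono[of "exp (s * k) * (1 - s * k)" 1 "1 - s / t"] by simp
  have "exp (s * k) = s / t * (exp (s * k) * (1 + (t - s) * k)) + (1 - s / t) * (exp (s * k) * (1 - s * k))"
    using assms by (simp add: field_simps)
  then show ?thesis using 1 2 by linarith
qed

lemma finite_set_pmf_finite [simp]: "finite (set_pmf (p :: 'b::finite pmf))"
  by simp

lemma mean_strict_mono:
  fixes p :: "'b::finite pmf"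
  assumes "\<And>x. f x \<le> g x" "f a < g a" "0 < pmf p a"
  shows "mean p f < mean p g"
proof -
  have "(\<Sum>x\<in>UNIV. f x * pmf p x) < (\<Sum>x\<in>UNIV. g x * pmf p x)"
    using assms by (intro sum_strict_mono_ex1) (auto intro!: mult_right_mono exI[of _ a])
  then show ?thesis by (simp add: integral_measure_pmf_real[of UNIV])
qed

lemma map_zip_proj:
  assumes "length u = length v"
  shows "map (\<lambda>z. h (fst z)) (zip u v) = map h u" "map (\<lambda>z. h (snd z)) (zip u v) = map h v"
  using assms by (induction u v rule: list_induct2) auto

locale score_model =
  fixes \<mu> :: "'a::finite pmf" and K :: "'a \<Rightarrow> 'a \<Rightarrow> real"
  assumes mu_pos: "0 < pmf \<mu> a"
    and K_sym: "K a b = K b a"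
    and K_mean: "mean (pair_pmf \<mu> \<mu>) (\<lambda>z. K (fst z) (snd z)) < 0"
    and K_pos: "\<exists>a b. 0 < K a b"
begin

abbreviation "\<pi> \<equiv> pair_pmf \<mu> \<mu>"

abbreviation "\<kappa> z \<equiv> K (fst z) (snd z)"

definition mgf :: "real \<Rightarrow> real" where
  "mgf t = mean \<pi> (\<lambda>z. exp (t * \<kappa> z))"

lemma pair_pos: "0 < pmf \<pi> z"
  by (cases z) (simp add: pmf_pair mu_pos)

lemma mgf_strict_convex:
  assumes "0 < s" "s < t"
  shows "mgf s < 1 - s / t + s / t * mgf t"
proof -
  obtain a b where ab: "0 < K a b" using K_pos by blast
  have "mgf s < mean \<pi> (\<lambda>z. 1 - s / t + s / t * exp (t * \<kappa> z))"
    unfolding mgf_def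
  proof (rule mean_strict_mono)
    show "exp (s * \<kappa> z) \<le> 1 - s / t + s / t * exp (t * \<kappa> z)" for z
      using exp_strict_convex[OF assms, of "\<kappa> z"] by (cases "\<kappa> z = 0") auto
    show "exp (s * \<kappa> (a, b)) < 1 - s / t + s / t * exp (t * \<kappa> (a, b))"
      using exp_strict_convex[OF assms, of "\<kappa> (a, b)"] ab by simp
  qed (rule pair_pos)
  also have "\<dots> = 1 - s / t + s / t * mgf t"
    by (simp add: mgf_def mean_add)
  finally show ?thesis .
qed

text \<open>The slope of the moment generating function at \<open>0\<close> is the mean score, which is negative.\<close>
lemma mgf_small: "\<exists>s>0. mgf s < 1"
proof -
  have "((\<lambda>t. \<Sum>z\<in>UNIV. exp (t * \<kappa> z) * pmf \<pi> z) has_real_derivative mean \<pi> \<kappa>) (at 0)"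
    unfolding integral_measure_pmf_real[OF finite UNIV_I]
    by (rule derivative_eq_intros refl | simp)+
  moreover have "(\<lambda>t. \<Sum>z\<in>UNIV. exp (t * \<kappa> z) * pmf \<pi> z) = mgf"
    by (rule ext) (simp add: mgf_def integral_measure_pmf_real[OF finite UNIV_I])
  ultimately have "(mgf has_real_derivative mean \<pi> \<kappa>) (at 0)" by simp
  from DERIV_neg_dec_right[OF this K_mean] obtain d where
    d: "d > 0" "\<And>h. 0 < h \<Longrightarrow> h < d \<Longrightarrow> mgf (0 + h) < mgf 0" by auto
  have "mgf 0 = 1" by (simp add: mgf_def)
  then show ?thesis using d(1) d(2)[of "d / 2"] by (intro exI[of _ "d/2"]) auto
qed

lemma mgf_ex1: "\<exists>!\<theta>. 0 < \<theta> \<and> mgf \<theta> = 1"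
proof (rule ex_ex1I)
  obtain s where s: "0 < s" "mgf s < 1" using mgf_small by blast
  obtain a b where ab: "0 < K a b" using K_pos by blast
  define t where "t = s + 1 / (pmf \<pi> (a, b) * K a b)"
  have st: "s < t" using ab pair_pos by (simp add: t_def)
  have "1 \<le> pmf \<pi> (a, b) * (t * K a b)"
  proof -
    have "pmf \<pi> (a, b) * (t * K a b) = pmf \<pi> (a, b) * s * K a b + 1"
      using ab pair_pos[of "(a,b)"] by (simp add: t_def field_simps)
    then show ?thesis using ab s by simp
  qed
  also have "\<dots> \<le> pmf \<pi> (a, b) * exp (t * K a b)"
    by (intro mult_left_mono less_imp_le[OF exp_gt_self]) auto
  also have "\<dots> = (\<Sum>z\<in>{(a, b)}. exp (t * \<kappa> z) * pmf \<pi> z)" by simp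
  also have "\<dots> \<le> (\<Sum>z\<in>UNIV. exp (t * \<kappa> z) * pmf \<pi> z)"
    by (rule sum_mono2) auto
  also have "\<dots> = mgf t" by (simp add: mgf_def integral_measure_pmf_real[OF finite UNIV_I])
  finally have "1 \<le> mgf t" .
  moreover have "continuous_on {s..t} mgf"
    unfolding mgf_def integral_measure_pmf_real[OF finite UNIV_I]
    by (intro continuous_intros)
  ultimately obtain \<theta> where "s \<le> \<theta>" "\<theta> \<le> t" "mgf \<theta> = 1"
    using IVT'[of mgf s 1 t] s st by auto
  then show "\<exists>\<theta>. 0 < \<theta> \<and> mgf \<theta> = 1" using s by (intro exI[of _ \<theta>]) auto
next
  have "False" if "0 < s" "s < t" "mgf s = 1" "mgf t = 1" for s t
    using mgf_strict_convex[OF that(1,2)] that by simp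
  then show "s = t" if "0 < s \<and> mgf s = 1" "0 < t \<and> mgf t = 1" for s t
    using that by (meson linorder_neqE_linordered_idom)
qed

definition \<theta> :: real where "\<theta> = (THE \<theta>. 0 < \<theta> \<and> mgf \<theta> = 1)"

lemma theta_pos: "0 < \<theta>" and mgf_theta: "mgf \<theta> = 1"
  using theI'[OF mgf_ex1] by (simp_all add: \<theta>_def)

lemma mgf_less_one: "0 < s \<Longrightarrow> s < \<theta> \<Longrightarrow> mgf s < 1"
  using mgf_strict_convex[of s \<theta>] by (simp add: mgf_theta)

text \<open>The law that pairs of letters follow inside unusually high-scoring ungapped segments.\<close>
definition tilted :: "('a \<times> 'a) pmf" where
  "tilted = embed_pmf (\<lambda>z. pmf \<pi> z * exp (\<theta> * \<kappa> z))"

lemma pmf_tilted: "pmf tilted z = pmf \<pi> z * exp (\<theta> * \<kappa> z)"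
  unfolding tilted_def
proof (rule pmf_embed_pmf)
  show "(\<integral>\<^sup>+ z. ennreal (pmf \<pi> z * exp (\<theta> * \<kappa> z)) \<partial>count_space UNIV) = 1"
    using mgf_theta
    by (simp add: nn_integral_count_space_finite sum_ennreal mgf_def
        integral_measure_pmf_real[OF finite UNIV_I] mult.commute)
qed simp

lemma mean_tilted: "mean tilted f = mean \<pi> (\<lambda>z. exp (\<theta> * \<kappa> z) * f z)"
  by (simp add: integral_measure_pmf_real[OF finite UNIV_I] pmf_tilted mult_ac)

lemma mean_replicate_tilted:
  "mean (replicate_pmf n tilted) f
    = mean (replicate_pmf n \<pi>) (\<lambda>zs. exp (\<theta> * (\<Sum>z\<leftarrow>zs. \<kappa> z)) * f zs)"
proof (induction n arbitrary: f)
  case (Suc n)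
  show ?case
    unfolding mean_replicate_Suc[OF finite_set_pmf_finite] mean_tilted Suc
    by (simp add: distrib_left exp_add mult.assoc)
qed simp

lemma mean_tilted_swap: "mean tilted (\<lambda>z. f (prod.swap z)) = mean tilted f"
  unfolding integral_measure_pmf_real[OF finite UNIV_I]
  by (rule sum.reindex_bij_witness[of _ prod.swap prod.swap])
     (auto simp: pmf_tilted pmf_pair K_sym mult_ac)

definition drift :: real where "drift = mean tilted \<kappa>"

text \<open>The moment generating function takes the value \<open>1\<close> at \<open>0\<close> and at \<open>\<theta>\<close> and is strictly convex, so its
  slope at \<open>\<theta>\<close>, which is the drift, is positive.\<close>
lemma drift_pos: "0 < drift"
proof -
  obtain a b where ab: "0 < K a b" using K_pos by blast
  have "mean \<pi> (\<lambda>z. exp (\<theta> * \<kappa> z) - 1) < mean \<pi> (\<lambda>z. exp (\<theta> * \<kappa> z) * (\<theta> * \<kappa> z))"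
  proof (rule mean_strict_mono)
    have *: "exp x - 1 < exp x * x" if "x \<noteq> 0" for x :: real
    proof -
      have "exp x * (1 + (- x)) < exp x * exp (- x)"
        using one_plus_less_exp[of "- x"] that by simp
      then show ?thesis by (simp add: algebra_simps flip: exp_add)
    qed
    show "exp (\<theta> * \<kappa> z) - 1 \<le> exp (\<theta> * \<kappa> z) * (\<theta> * \<kappa> z)" for z
      using *[of "\<theta> * \<kappa> z"] by (cases "\<theta> * \<kappa> z = 0") auto
    show "exp (\<theta> * \<kappa> (a, b)) - 1 < exp (\<theta> * \<kappa> (a, b)) * (\<theta> * \<kappa> (a, b))"
      using *[of "\<theta> * \<kappa> (a, b)"] ab theta_pos by simp
  qed (rule pair_pos)
  moreover have "mean \<pi> (\<lambda>z. exp (\<theta> * \<kappa> z) - 1) = 0"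
    using mgf_theta by (simp add: mean_diff mgf_def)
  moreover have "mean \<pi> (\<lambda>z. exp (\<theta> * \<kappa> z) * (\<theta> * \<kappa> z)) = \<theta> * drift"
    unfolding drift_def mean_tilted by (simp flip: integral_mult_right_zero add: mult_ac)
  ultimately show ?thesis using theta_pos by (simp add: zero_less_mult_iff)
qed

text \<open>The density, with respect to \<open>\<mu>\<close>, of the first marginal of the tilted law.  As the score is
  symmetric, it is also the density of the second marginal.\<close>
definition marg :: "'a \<Rightarrow> real" where "marg a = mean \<mu> (\<lambda>b. exp (\<theta> * K a b))"

lemma marg_pos: "0 < marg a"
proof -
  have "mean \<mu> (\<lambda>b. 0) < marg a"
    unfolding marg_def by (rule mean_strict_mono[OF _ _ mu_pos]) auto
  then show ?thesis by simp
qed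

text \<open>The relative entropy of a marginal of the tilted law with respect to \<open>\<mu>\<close>.\<close>
definition ent :: real where "ent = mean tilted (\<lambda>z. ln (marg (fst z)))"

lemma ent_snd: "mean tilted (\<lambda>z. ln (marg (snd z))) = ent"
  using mean_tilted_swap[of "\<lambda>z. ln (marg (fst z))"] by (simp add: ent_def)

text \<open>Since \<open>\<theta> * \<kappa> z\<close> is the log-density of the tilted law with respect to \<open>\<mu> \<times> \<mu>\<close>, the difference
  \<open>\<theta> * drift - 2 * ent\<close> is the relative entropy of the tilted law with respect to the product of its
  marginals.  Its nonnegativity is Gibbs' inequality \<open>ln y \<le> y - 1\<close>.\<close>
lemma ent_le: "ent \<le> \<theta> * drift / 2"
proof -
  have "2 * ent - \<theta> * drift = mean tilted (\<lambda>z. ln (marg (fst z)) + ln (marg (snd z)) - \<theta> * \<kappa> z)"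
    by (simp add: mean_add mean_diff ent_snd drift_def) (simp add: ent_def)
  also have "\<dots> \<le> mean tilted (\<lambda>z. marg (fst z) * marg (snd z) * exp (- (\<theta> * \<kappa> z)) - 1)"
  proof (rule mean_mono)
    fix z :: "'a \<times> 'a"
    let ?y = "marg (fst z) * marg (snd z) * exp (- (\<theta> * \<kappa> z))"
    have "ln ?y \<le> ?y - 1" by (rule ln_le_minus_one) (simp add: marg_pos)
    then show "ln (marg (fst z)) + ln (marg (snd z)) - \<theta> * \<kappa> z \<le> ?y - 1"
      by (simp add: ln_mult marg_pos less_imp_neq[OF marg_pos, symmetric])
  qed simp
  also have "\<dots> = mean \<pi> (\<lambda>z. marg (fst z) * marg (snd z)) - 1"
  proof -
    have "mean tilted (\<lambda>z. marg (fst z) * marg (snd z) * exp (- (\<theta> * \<kappa> z)))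
      = mean \<pi> (\<lambda>z. marg (fst z) * marg (snd z))"
      unfolding mean_tilted by (rule mean_cong) (simp add: exp_minus)
    then show ?thesis by (simp add: mean_diff)
  qed
  also have "mean \<pi> (\<lambda>z. marg (fst z) * marg (snd z)) = mean \<mu> marg * mean \<mu> marg"
    by (simp add: mean_pair)
  also have "mean \<mu> marg = 1"
    using mgf_theta by (simp add: marg_def[abs_def] mgf_def mean_pair)
  finally show ?thesis by simp
qed

section \<open>Ungapped matches between blocks\<close>

lemma mean_exp_score_fixed:
  assumes "length u = L"
  shows "mean (replicate_pmf L \<mu>) (\<lambda>v. exp (\<theta> * (\<Sum>z\<leftarrow>zip u v. \<kappa> z))) = exp (\<Sum>a\<leftarrow>u. ln (marg a))"
  using assms
proof (induction u arbitrary: L)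
  case (Cons a u)
  then obtain n where L: "L = Suc n" "length u = n" by auto
  show ?case unfolding L mean_replicate_Suc[OF finite_set_pmf_finite]
    using Cons.IH[OF L(2)] marg_pos[of a]
    by (simp add: distrib_left exp_add flip: marg_def)
qed simp

lemma mean_exp_score_fixed':
  assumes "length v = L"
  shows "mean (replicate_pmf L \<mu>) (\<lambda>u. exp (\<theta> * (\<Sum>z\<leftarrow>zip u v. \<kappa> z))) = exp (\<Sum>a\<leftarrow>v. ln (marg a))"
proof -
  have "(\<Sum>z\<leftarrow>zip u v. \<kappa> z) = (\<Sum>z\<leftarrow>zip v u. \<kappa> z)" for u
    by (subst zip_commute) (simp add: o_def split_def K_sym)
  then show ?thesis using mean_exp_score_fixed[OF assms] by simp
qed

text \<open>Words of pairs whose average score and average marginal log-densities are within \<open>e\<close> of their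
  means under the tilted law.  Truncation to these words keeps the second moments small.\<close>
definition typical :: "real \<Rightarrow> ('a \<times> 'a) list \<Rightarrow> bool" where
  "typical e zs \<longleftrightarrow>
     \<bar>(\<Sum>z\<leftarrow>zs. \<kappa> z) - real (length zs) * drift\<bar> \<le> e * real (length zs) \<and>
     \<bar>(\<Sum>z\<leftarrow>zs. ln (marg (fst z))) - real (length zs) * ent\<bar> \<le> e * real (length zs) \<and>
     \<bar>(\<Sum>z\<leftarrow>zs. ln (marg (snd z))) - real (length zs) * ent\<bar> \<le> e * real (length zs)"

lemma typical_likely:
  assumes "0 < e"
  shows "\<exists>C. \<forall>L>0. mean (replicate_pmf L tilted) (\<lambda>zs. of_bool (\<not> typical e zs)) \<le> C / real L"
proof (intro exI allI impI)
  fix L :: nat assume L: "0 < L"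
  let ?R = "replicate_pmf L tilted"
  let ?v = "\<lambda>f. mean tilted (\<lambda>z. (f z)\<^sup>2)"
  let ?f = "\<lambda>z. ln (marg (fst z))" and ?g = "\<lambda>z. ln (marg (snd z))"
  note fin = finite_set_replicate_pmf[OF finite_set_pmf_finite]
  let ?P = "\<lambda>f zs. e * real L < \<bar>(\<Sum>z\<leftarrow>zs. f z) - real L * mean tilted f\<bar>"
  have "mean ?R (\<lambda>zs. of_bool (\<not> typical e zs))
    \<le> mean ?R (\<lambda>zs. of_bool (?P \<kappa> zs) + (of_bool (?P ?f zs) + of_bool (?P ?g zs)))"
    by (intro mean_mono[OF fin])
       (auto simp: typical_def length_replicate_pmf ent_snd simp flip: ent_def drift_def)
  also have "\<dots> = mean ?R (\<lambda>zs. of_bool (?P \<kappa> zs)) + (mean ?R (\<lambda>zs. of_bool (?P ?f zs))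
      + mean ?R (\<lambda>zs. of_bool (?P ?g zs)))"
    by (simp only: mean_add[OF fin])
  also have "\<dots> \<le> ?v \<kappa> / (e\<^sup>2 * real L) + (?v ?f / (e\<^sup>2 * real L) + ?v ?g / (e\<^sup>2 * real L))"
    by (intro add_mono weak_law_replicate L assms) auto
  also have "\<dots> = (?v \<kappa> + (?v ?f + ?v ?g)) / e\<^sup>2 / real L"
    by (simp add: add_divide_distrib)
  finally show "mean ?R (\<lambda>zs. of_bool (\<not> typical e zs)) \<le> (?v \<kappa> + (?v ?f + ?v ?g)) / e\<^sup>2 / real L" .
qed

text \<open>The weight of a pair of blocks is \<open>exp (\<theta> S)\<close> on typical pairs.  Its mean is the probability of
  typical words under the tilted law, at least \<open>1/2\<close>.  Its second moment is at most the largest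
  weight, \<open>exp (\<theta> (drift + e) L)\<close>.  For a fixed first block \<open>u\<close> its mean is at most the density of
  \<open>u\<close> under the tilted marginal, which typicality bounds by \<open>exp ((ent + e) L)\<close>.\<close>
lemma block_pair_second_moment:
  assumes e: "0 < e" and N: "0 < N"
    and half: "mean (replicate_pmf L tilted) (\<lambda>zs. of_bool (\<not> typical e zs)) \<le> 1 / 2"
  shows "mean (replicate_pmf N (replicate_pmf L \<mu>)) (\<lambda>us. mean (replicate_pmf N (replicate_pmf L \<mu>))
      (\<lambda>vs. of_bool (\<forall>u\<in>set us. \<forall>v\<in>set vs. \<not> typical e (zip u v))))
    \<le> 4 * (exp (\<theta> * (drift + e) * L) / (real N)\<^sup>2 + 2 * exp ((ent + e) * L) / real N)"
proof -
  let ?R = "replicate_pmf L \<mu>"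
  note fin = finite_set_replicate_pmf[OF finite_set_pmf_finite, of L]
  define w where "w u v = exp (\<theta> * (\<Sum>z\<leftarrow>zip u v. \<kappa> z)) * of_bool (typical e (zip u v))" for u v
  have nonneg: "0 \<le> w u v" for u v by (simp add: w_def)
  define q where "q = mean ?R (\<lambda>u. mean ?R (w u))"
  define s where "s = exp (\<theta> * (drift + e) * L)"
  define r where "r = exp ((ent + e) * L)"
  have q_eq: "q = mean (replicate_pmf L tilted) (\<lambda>zs. of_bool (typical e zs))"
    unfolding q_def w_def mean_replicate_tilted
    by (subst mean_replicate_zip[symmetric]) auto
  then have q_eq': "q = 1 - mean (replicate_pmf L tilted) (\<lambda>zs. of_bool (\<not> typical e zs))"
    using mean_diff[OF finite_set_replicate_pmf[OF finite_set_pmf_finite], of L tilted "\<lambda>_. 1" "\<lambda>zs. of_bool (typical e zs)"]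
    by (simp add: of_bool_not_iff)
  have q: "1 / 2 \<le> q" "q \<le> 1"
    using half unfolding q_eq' by auto
  have S: "mean ?R (\<lambda>u. mean ?R (\<lambda>v. (w u v)\<^sup>2)) \<le> s"
  proof -
    have "mean ?R (\<lambda>u. mean ?R (\<lambda>v. (w u v)\<^sup>2)) \<le> mean ?R (\<lambda>u. mean ?R (\<lambda>v. s * w u v))"
    proof (intro mean_mono[OF fin])
      fix u v assume uv: "u \<in> set_pmf ?R" "v \<in> set_pmf ?R"
      have "w u v \<le> s"
      proof (cases "typical e (zip u v)")
        case True
        then have "(\<Sum>z\<leftarrow>zip u v. \<kappa> z) \<le> (drift + e) * L"
          using uv by (simp add: typical_def length_replicate_pmf algebra_simps abs_le_iff)
        then show ?thesis using theta_pos True by (simp add: w_def s_def mult.assoc)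
      qed (simp add: w_def s_def)
      then show "(w u v)\<^sup>2 \<le> s * w u v"
        unfolding power2_eq_square by (rule mult_right_mono) (rule nonneg)
    qed
    also have "\<dots> = s * q" by (simp add: q_def)
    also have "\<dots> \<le> s" using q(2) by (simp add: s_def)
    finally show ?thesis .
  qed
  \<comment> \<open>The conditional mean \<open>h\<close> is at most \<open>r\<close>, so its square is at most \<open>r\<close> times itself, and
      averaging the remaining factor gives \<open>q \<le> 1\<close>.\<close>
  have bnd: "(mean ?R h)\<^sup>2 \<le> r * mean ?R h"
    if h: "\<And>x. x \<in> set_pmf ?R \<Longrightarrow> h x \<le> g x" "\<And>x. 0 \<le> h x" "mean ?R g \<le> r" for h g
  proof -
    have "mean ?R h \<le> mean ?R g" by (rule mean_mono[OF fin]) (rule h)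
    also have "\<dots> \<le> r" by (rule h)
    finally show ?thesis unfolding power2_eq_square using h(2) by (intro mult_right_mono) auto
  qed
  have R1: "mean ?R (\<lambda>u. (mean ?R (w u))\<^sup>2) \<le> r"
  proof -
    have "mean ?R (\<lambda>u. (mean ?R (w u))\<^sup>2) \<le> mean ?R (\<lambda>u. r * mean ?R (w u))"
    proof (intro mean_mono[OF fin] bnd)
      fix u v assume u: "u \<in> set_pmf ?R" and v: "v \<in> set_pmf ?R"
      let ?b = "of_bool ((\<Sum>a\<leftarrow>u. ln (marg a)) \<le> (ent + e) * L)"
      have "(\<Sum>z\<leftarrow>zip u v. ln (marg (fst z))) = (\<Sum>a\<leftarrow>u. ln (marg a))"
        using map_zip_proj(1)[of u v "\<lambda>a. ln (marg a)"] u v by (simp add: length_replicate_pmf)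
      then show "w u v \<le> exp (\<theta> * (\<Sum>z\<leftarrow>zip u v. \<kappa> z)) * ?b"
        using u v by (auto simp: w_def typical_def length_replicate_pmf algebra_simps abs_le_iff)
      show "mean ?R (\<lambda>v. exp (\<theta> * (\<Sum>z\<leftarrow>zip u v. \<kappa> z)) * ?b) \<le> r"
        using mean_exp_score_fixed[of u L] u by (auto simp: length_replicate_pmf r_def)
    qed (rule nonneg)
    also have "\<dots> = r * q" by (simp add: q_def)
    also have "\<dots> \<le> r" using q(2) by (simp add: r_def)
    finally show ?thesis .
  qed
  have R2: "mean ?R (\<lambda>v. (mean ?R (\<lambda>u. w u v))\<^sup>2) \<le> r"
  proof -
    have "mean ?R (\<lambda>v. (mean ?R (\<lambda>u. w u v))\<^sup>2) \<le> mean ?R (\<lambda>v. r * mean ?R (\<lambda>u. w u v))"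
    proof (intro mean_mono[OF fin] bnd)
      fix u v assume u: "u \<in> set_pmf ?R" and v: "v \<in> set_pmf ?R"
      let ?b = "of_bool ((\<Sum>a\<leftarrow>v. ln (marg a)) \<le> (ent + e) * L)"
      have "(\<Sum>z\<leftarrow>zip u v. ln (marg (snd z))) = (\<Sum>a\<leftarrow>v. ln (marg a))"
        using map_zip_proj(2)[of u v "\<lambda>a. ln (marg a)"] u v by (simp add: length_replicate_pmf)
      then show "w u v \<le> exp (\<theta> * (\<Sum>z\<leftarrow>zip u v. \<kappa> z)) * ?b"
        using u v by (auto simp: w_def typical_def length_replicate_pmf algebra_simps abs_le_iff)
      show "mean ?R (\<lambda>u. exp (\<theta> * (\<Sum>z\<leftarrow>zip u v. \<kappa> z)) * ?b) \<le> r"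
        using mean_exp_score_fixed'[of v L] v by (auto simp: length_replicate_pmf r_def)
    qed (rule nonneg)
    also have "\<dots> = r * q" unfolding q_def by (subst mean_swap[OF fin fin]) simp
    also have "\<dots> \<le> r" using q(2) by (simp add: r_def)
    finally show ?thesis .
  qed
  have "mean (replicate_pmf N ?R) (\<lambda>us. mean (replicate_pmf N ?R)
      (\<lambda>vs. of_bool (\<forall>u\<in>set us. \<forall>v\<in>set vs. w u v = 0))) \<le> (s / (real N)\<^sup>2 + 2 * r / real N) / q\<^sup>2"
    by (rule second_moment_pairs[OF fin nonneg q_def[symmetric] _ S R1 R2 N]) (use q in simp)
  also have "\<dots> \<le> (s / (real N)\<^sup>2 + 2 * r / real N) / (1 / 2)\<^sup>2"
    using q by (intro divide_left_mono power_mono add_nonneg_nonneg) (auto simp: s_def r_def)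
  also have "\<dots> = 4 * (s / (real N)\<^sup>2 + 2 * r / real N)" by (simp add: power2_eq_square)
  finally show ?thesis unfolding w_def s_def r_def by simp
qed

lemma block_pair_score_likely:
  assumes "m' < drift" "\<theta> * drift / 2 < \<eta>" "0 < \<epsilon>"
  shows "\<forall>\<^sub>F L in sequentially. \<forall>N. exp (\<eta> * real L) \<le> real N \<longrightarrow>
    mean (replicate_pmf N (replicate_pmf L \<mu>)) (\<lambda>us. mean (replicate_pmf N (replicate_pmf L \<mu>))
      (\<lambda>vs. of_bool (\<forall>u\<in>set us. \<forall>v\<in>set vs. (\<Sum>z\<leftarrow>zip u v. \<kappa> z) < m' * real L))) \<le> \<epsilon>"
proof -
  \<comment> \<open>Small enough that \<open>N = exp (\<eta> L)\<close> beats both error terms of the second moment bound: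
      \<open>\<theta> (drift + e) < 2 \<eta>\<close> and, by the entropy inequality, \<open>ent + e < \<eta>\<close>.\<close>
  define e where "e = min (drift - m') (min ((\<eta> - \<theta> * drift / 2) / \<theta>) ((\<eta> - \<theta> * drift / 2) / 2))"
  have e: "0 < e" "e \<le> drift - m'" "e \<le> (\<eta> - \<theta> * drift / 2) / \<theta>" "e \<le> (\<eta> - \<theta> * drift / 2) / 2"
    using assms theta_pos unfolding e_def min_less_iff_conj min_le_iff_disj by auto
  have "\<theta> * e \<le> \<eta> - \<theta> * drift / 2" using e(3) theta_pos by (simp add: field_simps)
  then have c1: "\<theta> * (drift + e) - 2 * \<eta> < 0" using assms(2) by (simp add: algebra_simps)
  have c2: "ent + e - \<eta> < 0" using e(4) ent_le assms(2) by (simp add: field_simps)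
  let ?B = "\<lambda>L. 4 * (exp ((\<theta> * (drift + e) - 2 * \<eta>) * real L) + 2 * exp ((ent + e - \<eta>) * real L))"
  have quot1: "exp (c * real L) / (exp (\<eta> * real L))\<^sup>2 = exp ((c - 2 * \<eta>) * real L)" for c L
    by (simp add: left_diff_distrib exp_diff mult.assoc exp_double)
  have quot2: "2 * exp (c * real L) / exp (\<eta> * real L) = 2 * exp ((c - \<eta>) * real L)" for c L
    by (simp add: left_diff_distrib exp_diff)
  obtain C where C: "\<And>L. 0 < L \<Longrightarrow>
      mean (replicate_pmf L tilted) (\<lambda>zs. of_bool (\<not> typical e zs)) \<le> C / real L"
    using typical_likely[OF e(1)] by blast
  have "(\<lambda>L. C / real L) \<longlonglongrightarrow> 0" by real_asymp
  then have "\<forall>\<^sub>F L in sequentially. C / real L < 1 / 2" by (rule order_tendstoD) simp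
  moreover have ex: "(\<lambda>L. exp (c * real L)) \<longlonglongrightarrow> 0" if "c < 0" for c
    using that by real_asymp
  have "?B \<longlonglongrightarrow> 4 * (0 + 2 * 0)"
    by (intro tendsto_intros ex c1 c2)
  then have "\<forall>\<^sub>F L in sequentially. ?B L < \<epsilon>" using assms(3) by (intro order_tendstoD) auto
  moreover have "\<forall>\<^sub>F L in sequentially. 0 < L" by (rule eventually_gt_at_top)
  ultimately show ?thesis
  proof eventually_elim
    case (elim L)
    show ?case
    proof (intro allI impI)
      fix N :: nat assume N: "exp (\<eta> * real L) \<le> real N"
      have N0: "0 < N" using N exp_gt_zero[of "\<eta> * real L"] by (cases N) auto
      let ?R = "replicate_pmf N (replicate_pmf L \<mu>)"
      note fin = finite_set_replicate_pmf[OF finite_set_replicate_pmf[OF finite_set_pmf_finite]]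
      have "mean ?R (\<lambda>us. mean ?R (\<lambda>vs. of_bool (\<forall>u\<in>set us. \<forall>v\<in>set vs. (\<Sum>z\<leftarrow>zip u v. \<kappa> z) < m' * real L)))
        \<le> mean ?R (\<lambda>us. mean ?R (\<lambda>vs. of_bool (\<forall>u\<in>set us. \<forall>v\<in>set vs. \<not> typical e (zip u v))))"
      proof (intro mean_mono fin)
        fix us vs assume us: "us \<in> set_pmf ?R" and vs: "vs \<in> set_pmf ?R"
        have "m' * real L \<le> (\<Sum>z\<leftarrow>zip u v. \<kappa> z)" if "u \<in> set us" "v \<in> set vs" "typical e (zip u v)" for u v
        proof -
          have len: "length u = L" "length v = L"
            using that us vs by (auto simp: set_replicate_pmf)
          have "drift * real L - (\<Sum>z\<leftarrow>zip u v. \<kappa> z) \<le> e * real L"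
            using that(3) len by (simp add: typical_def abs_le_iff algebra_simps)
          also have "\<dots> \<le> (drift - m') * real L" using e(2) by (intro mult_right_mono) auto
          finally show ?thesis by (simp add: algebra_simps)
        qed
        then show "of_bool (\<forall>u\<in>set us. \<forall>v\<in>set vs. (\<Sum>z\<leftarrow>zip u v. \<kappa> z) < m' * real L)
          \<le> (of_bool (\<forall>u\<in>set us. \<forall>v\<in>set vs. \<not> typical e (zip u v)) :: real)"
          by (force simp: not_less)
      qed
      also have "\<dots> \<le> 4 * (exp (\<theta> * (drift + e) * L) / (real N)\<^sup>2 + 2 * exp ((ent + e) * L) / real N)"
        by (rule block_pair_second_moment[OF e(1) N0]) (use C[of L] elim in linarith)
      also have "\<dots> \<le> 4 * (exp (\<theta> * (drift + e) * L) / (exp (\<eta> * real L))\<^sup>2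
          + 2 * exp ((ent + e) * L) / exp (\<eta> * real L))"
        using N N0 by (intro mult_left_mono add_mono divide_left_mono power_mono) auto
      also have "\<dots> = ?B L"
        unfolding quot1 quot2 by simp
      also have "\<dots> \<le> \<epsilon>" using elim by simp
      finally show "mean ?R (\<lambda>us. mean ?R (\<lambda>vs. of_bool (\<forall>u\<in>set us. \<forall>v\<in>set vs.
          (\<Sum>z\<leftarrow>zip u v. \<kappa> z) < m' * real L))) \<le> \<epsilon>" .
    qed
  qed
qed

end

section \<open>Transfer to independent letters on a probability space\<close>

lemma pmf_replicate_pmf:
  "pmf (replicate_pmf n p) xs = (if length xs = n then \<Prod>k<n. pmf p (xs ! k) else 0)"
proof (cases "length xs = n")
  case False
  then have "xs \<notin> set_pmf (replicate_pmf n p)" by (auto simp: set_replicate_pmf)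
  then show ?thesis using False by (simp add: pmf_eq_0_set_pmf)
next
  case True
  then show ?thesis
  proof (induction xs arbitrary: n)
    case (Cons x xs)
    then obtain k where n: "n = Suc k" and k: "length xs = k" by auto
    have "replicate_pmf n p = map_pmf (\<lambda>(x, xs). x # xs) (pair_pmf p (replicate_pmf k p))"
      by (simp add: n pair_pmf_def map_bind_pmf)
    moreover have "inj (\<lambda>(x, xs). x # xs)" by (auto simp: inj_def)
    ultimately have "pmf (replicate_pmf n p) (x # xs) = pmf (pair_pmf p (replicate_pmf k p)) (x, xs)"
      using pmf_map_inj'[of "\<lambda>(x, xs). x # xs" _ "(x, xs)"] by simp
    then show ?case using Cons.IH[OF k] k n
      by (simp add: pmf_pair prod.lessThan_Suc_shift del: prod.lessThan_Suc)
  qed simp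
qed

locale iid_words = prob_space M for M :: "'w measure" +
  fixes X Y :: "nat \<Rightarrow> 'w \<Rightarrow> 'a::finite" and \<mu> :: "'a pmf"
  assumes iid: "iid_letters M X Y \<mu>"
begin

abbreviation "Z \<equiv> case_sum X Y"

text \<open>There are countably many words, so it suffices to compare the probabilities of single words, which
  factorise on both sides.  The list \<open>ks\<close> may take its positions anywhere and in any order: the
  letters of an alignment and those of a shifted word are both of this form.\<close>
lemma law_letters:
  assumes ks: "distinct ks" "set ks \<subseteq> {1..} <+> {1..}"
  shows "(\<lambda>\<omega>. map (\<lambda>i. Z i \<omega>) ks) \<in> M \<rightarrow>\<^sub>M count_space UNIV" (is ?meas)
    and "distr M (count_space UNIV) (\<lambda>\<omega>. map (\<lambda>i. Z i \<omega>) ks) = measure_pmf (replicate_pmf (length ks) \<mu>)" (is ?law)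
proof -
  let ?n = "length ks"
  let ?f = "\<lambda>\<omega>. map (\<lambda>i. Z i \<omega>) ks"
  have indep: "indep_vars (\<lambda>_. count_space UNIV) Z ({1..} <+> {1..})"
    and dist: "\<And>i. i \<in> {1..} <+> {1..} \<Longrightarrow> distr M (count_space UNIV) (Z i) = measure_pmf \<mu>"
    using iid by (auto simp: iid_letters_def)
  have rv: "random_variable (count_space UNIV) (Z i)" if "i \<in> {1..} <+> {1..}" for i
    using indep that by (auto simp: indep_vars_def)
  have mem: "ks ! k \<in> {1..} <+> {1..}" if "k < ?n" for k
    using ks that nth_mem by blast
  have pre: "?f -` {xs} \<inter> space M
    = (if length xs = ?n then {\<omega> \<in> space M. \<forall>k<?n. Z (ks ! k) \<omega> = xs ! k} else {})" for xs
    by (auto simp: list_eq_iff_nth_eq)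
  have sets: "?f -` {xs} \<inter> space M \<in> sets M" for xs
  proof -
    have "{\<omega> \<in> space M. Z (ks ! k) \<omega> = xs ! k} \<in> sets M" if "k < ?n" for k
    proof -
      have "Z (ks ! k) -` {xs ! k} \<inter> space M \<in> sets M"
        by (rule measurable_sets[OF rv[OF mem[OF that]]]) simp
      then show ?thesis by (simp add: vimage_def Int_def conj_commute)
    qed
    then show ?thesis unfolding pre by (auto intro!: sets.sets_Collect_finite_All')
  qed
  have cnt: "countable (UNIV :: 'a list set)"
    using countable_lists[of "UNIV :: 'a set"] by (simp add: countable_finite)
  show meas: ?meas
  proof (rule measurableI)
    fix A :: "'a list set"
    have "?f -` A \<inter> space M = (\<Union>xs\<in>A. ?f -` {xs} \<inter> space M)" by auto
    also have "\<dots> \<in> sets M"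
      using sets countable_subset[OF subset_UNIV cnt] by (intro sets.countable_UN'') auto
    finally show "?f -` A \<inter> space M \<in> sets M" .
  qed simp
  show ?law
  proof (rule measure_eqI_countable[of _ UNIV])
    fix xs :: "'a list"
    have "prob (?f -` {xs} \<inter> space M) = pmf (replicate_pmf ?n \<mu>) xs"
    proof (cases "length xs = ?n \<and> 0 < ?n")
      case True
      have inj: "inj_on ((!) ks) {..<?n}" using ks(1) by (simp add: inj_on_nth)
      let ?J = "(!) ks ` {..<?n}" and ?A = "\<lambda>i. {xs ! inv_into {..<?n} ((!) ks) i}"
      have "indep_vars (\<lambda>_. count_space UNIV) Z ?J"
        using indep by (rule indep_vars_subset) (use mem in auto)
      from indep_varsD_finite[OF this, of ?A] True
      have "prob (\<Inter>i\<in>?J. Z i -` ?A i \<inter> space M) = (\<Prod>i\<in>?J. prob (Z i -` ?A i \<inter> space M))" by auto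
      moreover have inv: "inv_into {..<?n} ((!) ks) (ks ! k) = k" if "k \<in> {..<?n}" for k
        using inv_into_f_f[OF inj that] .
      moreover have "(\<Inter>i\<in>?J. Z i -` ?A i \<inter> space M) = (\<Inter>k\<in>{..<?n}. Z (ks ! k) -` {xs ! k} \<inter> space M)"
        unfolding INF_image o_def by (intro INF_cong refl) (simp add: inv)
      moreover have "(\<Prod>i\<in>?J. prob (Z i -` ?A i \<inter> space M)) = (\<Prod>k<?n. prob (Z (ks ! k) -` {xs ! k} \<inter> space M))"
        unfolding prod.reindex[OF inj] o_def by (intro prod.cong refl) (simp add: inv)
      ultimately have "prob (\<Inter>k\<in>{..<?n}. Z (ks ! k) -` {xs ! k} \<inter> space M)
        = (\<Prod>k<?n. prob (Z (ks ! k) -` {xs ! k} \<inter> space M))"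
        by simp
      also have "(\<Inter>k\<in>{..<?n}. Z (ks ! k) -` {xs ! k} \<inter> space M) = ?f -` {xs} \<inter> space M"
        using True unfolding pre by auto
      also have "(\<Prod>k<?n. prob (Z (ks ! k) -` {xs ! k} \<inter> space M)) = (\<Prod>k<?n. pmf \<mu> (xs ! k))"
      proof (rule prod.cong)
        fix k assume "k \<in> {..<?n}"
        then have k: "ks ! k \<in> {1..} <+> {1..}" using mem by auto
        have "prob (Z (ks ! k) -` {xs ! k} \<inter> space M) = measure (distr M (count_space UNIV) (Z (ks ! k))) {xs ! k}"
          using rv[OF k] by (simp add: measure_distr)
        then show "prob (Z (ks ! k) -` {xs ! k} \<inter> space M) = pmf \<mu> (xs ! k)"
          unfolding dist[OF k] by (simp add: measure_pmf_single)
      qed simp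
      finally show ?thesis using True by (simp add: pmf_replicate_pmf)
    next
      case False
      then show ?thesis unfolding pre by (auto simp: pmf_replicate_pmf prob_space)
    qed
    then show "emeasure (distr M (count_space UNIV) ?f) {xs} = emeasure (measure_pmf (replicate_pmf ?n \<mu>)) {xs}"
      using meas by (simp add: emeasure_distr emeasure_eq_measure emeasure_pmf_single)
  qed (use cnt in auto)
qed

lemma expectation_letters:
  fixes F :: "'a list \<Rightarrow> 'a list \<Rightarrow> real"
  assumes "distinct ks" "distinct js" "\<forall>i\<in>set ks. 1 \<le> i" "\<forall>j\<in>set js. 1 \<le> j"
  shows "integrable M (\<lambda>\<omega>. F (map (\<lambda>i. X i \<omega>) ks) (map (\<lambda>j. Y j \<omega>) js))"
    and "expectation (\<lambda>\<omega>. F (map (\<lambda>i. X i \<omega>) ks) (map (\<lambda>j. Y j \<omega>) js))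
      = mean (replicate_pmf (length ks) \<mu>) (\<lambda>xs. mean (replicate_pmf (length js) \<mu>) (F xs))"
proof -
  let ?ks = "map Inl ks @ map Inr js"
  let ?F = "\<lambda>zs. F (take (length ks) zs) (drop (length ks) zs)"
  have ks: "distinct ?ks" "set ?ks \<subseteq> {1..} <+> {1..}"
    using assms by (auto simp: distinct_map)
  note law = law_letters[OF ks]
  have eq: "F (map (\<lambda>i. X i \<omega>) ks) (map (\<lambda>j. Y j \<omega>) js) = ?F (map (\<lambda>i. Z i \<omega>) ?ks)" for \<omega>
    by (simp add: o_def)
  have fin: "finite (set_pmf (replicate_pmf (length ?ks) \<mu>))"
    by (simp only: finite_set_replicate_pmf[OF finite_set_pmf_finite])
  have int: "integrable (measure_pmf (replicate_pmf (length ?ks) \<mu>)) ?F"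
    using fin by (rule integrable_measure_pmf_finite)
  show "integrable M (\<lambda>\<omega>. F (map (\<lambda>i. X i \<omega>) ks) (map (\<lambda>j. Y j \<omega>) js))"
    unfolding eq using int unfolding law(2)[symmetric]
    by (subst (asm) integrable_distr_eq[OF law(1)]) auto
  have "expectation (\<lambda>\<omega>. F (map (\<lambda>i. X i \<omega>) ks) (map (\<lambda>j. Y j \<omega>) js))
    = mean (replicate_pmf (length ?ks) \<mu>) ?F"
    unfolding eq law(2)[symmetric] by (subst integral_distr[OF law(1)]) auto
  also have "\<dots> = mean (replicate_pmf (length ks) \<mu>) (\<lambda>xs. mean (replicate_pmf (length js) \<mu>) (F xs))"
    unfolding length_append length_map mean_replicate_add[OF finite_set_pmf_finite]
    by (intro mean_cong) (simp add: length_replicate_pmf)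
  finally show "expectation (\<lambda>\<omega>. F (map (\<lambda>i. X i \<omega>) ks) (map (\<lambda>j. Y j \<omega>) js))
      = mean (replicate_pmf (length ks) \<mu>) (\<lambda>xs. mean (replicate_pmf (length js) \<mu>) (F xs))" .
qed

end

lemma (in iid_words) expectation_first_letters:
  fixes F :: "'a \<Rightarrow> 'a \<Rightarrow> real"
  shows "expectation (\<lambda>\<omega>. F (X 1 \<omega>) (Y 1 \<omega>)) = mean (pair_pmf \<mu> \<mu>) (\<lambda>z. F (fst z) (snd z))"
  using expectation_letters(2)[of "[1]" "[1]" "\<lambda>xs ys. F (hd xs) (hd ys)"]
  by (simp add: mean_replicate_Suc mean_pair del: replicate_pmf.simps(2))

definition word :: "'b list \<Rightarrow> nat \<Rightarrow> 'b" where "word xs i = xs ! (i - 1)"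

definition depends_on_prefix :: "nat \<Rightarrow> ((nat \<Rightarrow> 'b) \<Rightarrow> (nat \<Rightarrow> 'b) \<Rightarrow> 'c) \<Rightarrow> bool" where
  "depends_on_prefix n F \<longleftrightarrow> (\<forall>x x' y y'. (\<forall>i\<in>{1..n}. x i = x' i) \<longrightarrow> (\<forall>i\<in>{1..n}. y i = y' i) \<longrightarrow> F x y = F x' y')"

text \<open>Stationarity: the right-hand side does not mention the starting point \<open>m\<close>.\<close>
lemma (in iid_words) expectation_depends:
  fixes F :: "(nat \<Rightarrow> 'a) \<Rightarrow> (nat \<Rightarrow> 'a) \<Rightarrow> real"
  assumes "depends_on_prefix n F"
  shows "integrable M (\<lambda>\<omega>. F (\<lambda>i. X (m + i) \<omega>) (\<lambda>j. Y (m + j) \<omega>))"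
    and "expectation (\<lambda>\<omega>. F (\<lambda>i. X (m + i) \<omega>) (\<lambda>j. Y (m + j) \<omega>))
      = mean (replicate_pmf n \<mu>) (\<lambda>xs. mean (replicate_pmf n \<mu>) (\<lambda>ys. F (word xs) (word ys)))"
proof -
  let ?ks = "map (\<lambda>k. m + Suc k) [0..<n]"
  have "F (\<lambda>i. X (m + i) \<omega>) (\<lambda>j. Y (m + j) \<omega>)
      = F (word (map (\<lambda>i. X i \<omega>) ?ks)) (word (map (\<lambda>j. Y j \<omega>) ?ks))" for \<omega>
    using assms unfolding depends_on_prefix_def by (elim allE impE) (auto simp: word_def)
  moreover have "distinct ?ks" "\<forall>i\<in>set ?ks. 1 \<le> i" by (auto simp: distinct_map inj_on_def)
  ultimately show "integrable M (\<lambda>\<omega>. F (\<lambda>i. X (m + i) \<omega>) (\<lambda>j. Y (m + j) \<omega>))"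
    and "expectation (\<lambda>\<omega>. F (\<lambda>i. X (m + i) \<omega>) (\<lambda>j. Y (m + j) \<omega>))
      = mean (replicate_pmf n \<mu>) (\<lambda>xs. mean (replicate_pmf n \<mu>) (\<lambda>ys. F (word xs) (word ys)))"
    using expectation_letters[of ?ks ?ks "\<lambda>xs ys. F (word xs) (word ys)"] by simp_all
qed

section \<open>Alignments as lists\<close>

text \<open>Recursion along the list makes joining and shifting of alignments accessible to induction.\<close>
fun score :: "('a \<Rightarrow> 'a \<Rightarrow> real) \<Rightarrow> (nat \<Rightarrow> real) \<Rightarrow> (nat \<Rightarrow> 'a) \<Rightarrow> (nat \<Rightarrow> 'a) \<Rightarrow> (nat \<times> nat) list \<Rightarrow> real"
where
  "score K g x y [] = 0"
| "score K g x y [p] = K (x (fst p)) (y (snd p))"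
| "score K g x y (p # q # z) = K (x (fst p)) (y (snd p))
     - (g (fst q - fst p - 1) + g (snd q - snd p - 1)) + score K g x y (q # z)"

lemma score_eq_sums:
  "score K g x y z = (\<Sum>t<length z. K (x (fst (z ! t))) (y (snd (z ! t))))
     - (\<Sum>t<length z - 1. g (fst (z ! Suc t) - fst (z ! t) - 1) + g (snd (z ! Suc t) - snd (z ! t) - 1))"
  by (induction K g x y z rule: score.induct)
     (simp_all add: sum.lessThan_Suc_shift del: sum.lessThan_Suc)

lemma score_append:
  assumes "z \<noteq> []" "z' \<noteq> []"
  shows "score K g x y (z @ z') = score K g x y z + score K g x y z'
    - (g (fst (hd z') - fst (last z) - 1) + g (snd (hd z') - snd (last z) - 1))"
  using assms
proof (induction z rule: induct_list012)
  case (2 p)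
  then show ?case by (cases z') auto
qed auto

definition fitting :: "nat \<Rightarrow> (nat \<times> nat) list set" where
  "fitting n = {z \<in> alignments. fst (last z) \<le> n \<and> snd (last z) \<le> n}"

lemma Nil_notin_alignments [simp]: "[] \<notin> alignments"
  by (simp add: alignments_def)

lemma single_in_alignments [simp]: "[p] \<in> alignments \<longleftrightarrow> 1 \<le> fst p \<and> 1 \<le> snd p"
  by (cases p) (auto simp: alignments_def)

lemma Cons_in_alignments [simp]:
  "p # q # z \<in> alignments \<longleftrightarrow>
     1 \<le> fst p \<and> 1 \<le> snd p \<and> fst p < fst q \<and> snd p < snd q \<and> q # z \<in> alignments"
proof -
  have "transp (\<lambda>p q :: nat \<times> nat. fst p < fst q \<and> snd p < snd q)" by (auto simp: transp_def)
  then show ?thesis by (cases p; cases q) (auto simp: alignments_def sorted_wrt2)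
qed

lemma alignments_append:
  assumes "z \<in> alignments" "z' \<in> alignments"
    "fst (last z) < fst (hd z')" "snd (last z) < snd (hd z')"
  shows "z @ z' \<in> alignments"
  using assms
proof (induction z rule: induct_list012)
  case (2 p)
  then show ?case by (cases z') auto
qed auto

definition shift :: "nat \<Rightarrow> (nat \<times> nat) list \<Rightarrow> (nat \<times> nat) list" where
  "shift m z = map (\<lambda>p. (m + fst p, m + snd p)) z"

lemma shift_simps [simp]:
  "shift m z = [] \<longleftrightarrow> z = []"
  "z \<noteq> [] \<Longrightarrow> hd (shift m z) = (m + fst (hd z), m + snd (hd z))"
  "z \<noteq> [] \<Longrightarrow> last (shift m z) = (m + fst (last z), m + snd (last z))"
  by (simp_all add: shift_def hd_map last_map)

lemma score_shift: "score K g x y (shift m z) = score K g (\<lambda>i. x (m + i)) (\<lambda>j. y (m + j)) z"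
  unfolding shift_def by (induction z rule: induct_list012) auto

lemma shift_in_alignments: "z \<in> alignments \<Longrightarrow> shift m z \<in> alignments"
  unfolding shift_def by (induction z rule: induct_list012) auto

lemma alignment_bounds:
  assumes "z \<in> alignments"
  shows "p \<in> set z \<Longrightarrow> fst p \<in> {1..fst (last z)} \<and> snd p \<in> {1..snd (last z)}"
    and "length z \<le> fst (last z)" "distinct (map fst z)" "distinct (map snd z)"
proof -
  let ?r = "\<lambda>p q :: nat \<times> nat. fst p < fst q \<and> snd p < snd q"
  have z: "z \<noteq> []" "sorted_wrt ?r z" "\<And>p. p \<in> set z \<Longrightarrow> 1 \<le> fst p \<and> 1 \<le> snd p"
    using assms by (auto simp: alignments_def)
  have le: "fst p \<le> fst (last z) \<and> snd p \<le> snd (last z)" if "p \<in> set z" for p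
  proof -
    have "sorted_wrt ?r (butlast z @ [last z])" "p \<in> set (butlast z @ [last z])"
      using z that by simp_all
    then show ?thesis unfolding sorted_wrt_append by auto
  qed
  then show bounds: "p \<in> set z \<Longrightarrow> fst p \<in> {1..fst (last z)} \<and> snd p \<in> {1..snd (last z)}" for p
    using z(3) by auto
  have "sorted_wrt (<) (map fst z)" "sorted_wrt (<) (map snd z)"
    unfolding sorted_wrt_map using z(2) by (auto elim: sorted_wrt_mono_rel[rotated])
  then show d: "distinct (map fst z)" "distinct (map snd z)"
    by (simp_all add: strict_sorted_iff)
  have "card (set (map fst z)) \<le> card {1..fst (last z)}"
    using bounds by (intro card_mono) auto
  then show "length z \<le> fst (last z)" unfolding distinct_card[OF d(1)] by simp
qed

lemma fitting_set: "z \<in> fitting n \<Longrightarrow> p \<in> set z \<Longrightarrow> fst p \<in> {1..n} \<and> snd p \<in> {1..n}"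
  using alignment_bounds(1)[of z p] by (auto simp: fitting_def)

lemma fitting_length: "z \<in> fitting n \<Longrightarrow> length z \<le> n"
  using alignment_bounds(2)[of z] by (auto simp: fitting_def)

lemma finite_fitting: "finite (fitting n)"
proof (rule finite_subset)
  show "fitting n \<subseteq> {z. set z \<subseteq> {1..n} \<times> {1..n} \<and> length z \<le> n}"
    using fitting_set fitting_length by fastforce
qed (simp add: finite_lists_length_le)

lemma fitting_nonempty: "1 \<le> n \<Longrightarrow> [(1, 1)] \<in> fitting n"
  by (simp add: fitting_def)

lemma fitting_mono: "m \<le> n \<Longrightarrow> fitting m \<subseteq> fitting n"
  by (auto simp: fitting_def)

definition edge_cost :: "(nat \<Rightarrow> real) \<Rightarrow> nat \<Rightarrow> (nat \<times> nat) list \<Rightarrow> real" where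
  "edge_cost g n z = g (fst (hd z) - 1) + g (snd (hd z) - 1) + g (n - fst (last z)) + g (n - snd (last z))"

definition local_max where "local_max K g n x y = Max (score K g x y ` fitting n)"

definition global_max where
  "global_max K g n x y = Max ((\<lambda>z. score K g x y z - edge_cost g n z) ` fitting n)"

text \<open>Only finitely many alignments fit into the words, so the suprema that define the scores are maxima
  of real numbers.\<close>
lemma SUP_fitting:
  fixes f :: "(nat \<times> nat) list \<Rightarrow> ereal"
  assumes n: "1 \<le> n" and "\<And>z. z \<in> fitting n \<Longrightarrow> f z = ereal (h z)"
    "\<And>z. z \<in> alignments - fitting n \<Longrightarrow> f z = -\<infinity>"
  shows "real_of_ereal (SUP z\<in>alignments. f z) = Max (h ` fitting n)"
proof -
  have ne: "fitting n \<noteq> {}" using fitting_nonempty[OF n] by auto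
  have "Max (h ` fitting n) \<in> h ` fitting n" using ne finite_fitting by simp
  then obtain z where z: "z \<in> fitting n" "Max (h ` fitting n) = h z" by auto
  have "(SUP z\<in>alignments. f z) = ereal (Max (h ` fitting n))"
  proof (rule antisym)
    show "(SUP z\<in>alignments. f z) \<le> ereal (Max (h ` fitting n))"
    proof (rule SUP_least)
      fix z' assume "z' \<in> alignments"
      then show "f z' \<le> ereal (Max (h ` fitting n))"
        using assms(2,3)[of z'] finite_fitting by (cases "z' \<in> fitting n") auto
    qed
    have "z \<in> alignments" using z by (simp add: fitting_def)
    then show "ereal (Max (h ` fitting n)) \<le> (SUP z\<in>alignments. f z)"
      using assms(2)[OF z(1)] SUP_upper[of z alignments f] z(2) by simp
  qed
  then show ?thesis by simp
qed

lemma H_score_eq: "1 \<le> n \<Longrightarrow> real_of_ereal (H_score K g x n y n) = local_max K g n x y"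
  unfolding H_score_def local_max_def
  by (rule SUP_fitting) (auto simp: local_align_score_def fitting_def score_eq_sums)

lemma G_score_eq: "1 \<le> n \<Longrightarrow> real_of_ereal (G_score K g x n y n) = global_max K g n x y"
  unfolding G_score_def global_max_def
  by (rule SUP_fitting)
     (auto simp: global_align_score_def local_align_score_def fitting_def score_eq_sums edge_cost_def)

lemma score_cong:
  assumes "\<And>p. p \<in> set z \<Longrightarrow> x (fst p) = x' (fst p) \<and> y (snd p) = y' (snd p)"
  shows "score K g x y z = score K g x' y' z"
  using assms by (induction z rule: induct_list012) auto

lemma score_cong_fitting:
  assumes "\<forall>i\<in>{1..n}. x i = x' i" "\<forall>i\<in>{1..n}. y i = y' i" "z \<in> fitting n"
  shows "score K g x y z = score K g x' y' z"
  using assms fitting_set[OF assms(3)] by (intro score_cong) blast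

lemma depends_local_max: "depends_on_prefix n (local_max K g n)"
  unfolding depends_on_prefix_def local_max_def
  by (intro allI impI arg_cong[of _ _ Max] image_cong refl score_cong_fitting)

lemma depends_global_max: "depends_on_prefix n (global_max K g n)"
  unfolding depends_on_prefix_def global_max_def
  by (intro allI impI arg_cong[of _ _ Max] image_cong refl arg_cong2[of _ _ _ _ "(-)"] score_cong_fitting)

lemma depends_comp:
  assumes "depends_on_prefix n F"
  shows "depends_on_prefix n (\<lambda>x y. f (F x y))"
  unfolding depends_on_prefix_def
proof (intro allI impI)
  fix x x' y y' :: "nat \<Rightarrow> 'a"
  assume "\<forall>i\<in>{1..n}. x i = x' i" "\<forall>i\<in>{1..n}. y i = y' i"
  then have "F x y = F x' y'" using assms unfolding depends_on_prefix_def by simp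
  then show "f (F x y) = f (F x' y')" by simp
qed

lemma local_max_ge_iff:
  "1 \<le> n \<Longrightarrow> t \<le> local_max K g n x y \<longleftrightarrow> (\<exists>z\<in>fitting n. t \<le> score K g x y z)"
  unfolding local_max_def using finite_fitting fitting_nonempty[of n] by (subst Max_ge_iff) auto

lemma global_max_ge_iff:
  "1 \<le> n \<Longrightarrow> t \<le> global_max K g n x y \<longleftrightarrow> (\<exists>z\<in>fitting n. t \<le> score K g x y z - edge_cost g n z)"
  unfolding global_max_def using finite_fitting fitting_nonempty[of n] by (subst Max_ge_iff) auto

lemma local_max_mono:
  assumes "1 \<le> m" "m \<le> n"
  shows "local_max K g m x y \<le> local_max K g n x y"
proof -
  have "\<exists>z\<in>fitting m. local_max K g m x y \<le> score K g x y z"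
    using local_max_ge_iff[OF assms(1)] by blast
  then show ?thesis using assms fitting_mono[OF assms(2)] by (subst local_max_ge_iff) auto
qed

primrec diag :: "nat \<Rightarrow> nat \<Rightarrow> nat \<Rightarrow> (nat \<times> nat) list" where
  "diag 0 i j = []"
| "diag (Suc L) i j = (Suc i, Suc j) # diag L (Suc i) (Suc j)"

lemma diag_alignment:
  assumes "g 0 = (0 :: real)"
  shows "diag (Suc L) i j \<in> alignments \<and> last (diag (Suc L) i j) = (i + Suc L, j + Suc L)
    \<and> score K g x y (diag (Suc L) i j) = (\<Sum>l\<le>L. K (x (Suc (i + l))) (y (Suc (j + l))))"
proof (induction L arbitrary: i j)
  case (Suc L)
  show ?case
    using Suc[of "Suc i" "Suc j"] assms
    by (auto simp: sum.atMost_Suc_shift simp del: sum.atMost_Suc)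
qed auto

lemma local_max_ge_diag:
  assumes "g 0 = 0" "0 < L" "i + L \<le> n" "j + L \<le> n"
  shows "(\<Sum>l<L. K (x (Suc (i + l))) (y (Suc (j + l)))) \<le> local_max K g n x y"
proof -
  obtain k where L: "L = Suc k" using assms(2) by (cases L) auto
  have "diag L i j \<in> fitting n"
    "score K g x y (diag L i j) = (\<Sum>l<L. K (x (Suc (i + l))) (y (Suc (j + l))))"
    using diag_alignment[where g=g and K=K and x=x and y=y and L=k and i=i and j=j, OF assms(1)] assms unfolding L fitting_def
    by (auto simp: lessThan_Suc_atMost simp del: diag.simps sum.lessThan_Suc)
  then show ?thesis using assms by (subst local_max_ge_iff) (auto intro!: bexI[of _ "diag L i j"])
qed

lemma block_in_concat:
  assumes "u \<in> set us"
  obtains i where "i + length u \<le> length (concat us)"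
    "\<And>l. l < length u \<Longrightarrow> word (concat us) (Suc (i + l)) = u ! l"
proof -
  obtain as bs where us: "us = as @ u # bs" using split_list[OF assms] by blast
  show ?thesis
    by (rule that[of "length (concat as)"]) (auto simp: us word_def nth_append)
qed

lemma local_max_ge_block_pair:
  assumes g: "g 0 = 0" and uv: "u \<in> set us" "v \<in> set vs"
    and len: "0 < L" "length u = L" "length v = L" "length (concat us) \<le> n" "length (concat vs) \<le> n"
  shows "(\<Sum>z\<leftarrow>zip u v. K (fst z) (snd z)) \<le> local_max K g n (word (concat us)) (word (concat vs))"
proof -
  obtain i where i: "i + length u \<le> length (concat us)"
    "\<And>l. l < length u \<Longrightarrow> word (concat us) (Suc (i + l)) = u ! l"
    using block_in_concat[OF uv(1)] by blast
  obtain j where j: "j + length v \<le> length (concat vs)"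
    "\<And>l. l < length v \<Longrightarrow> word (concat vs) (Suc (j + l)) = v ! l"
    using block_in_concat[OF uv(2)] by blast
  have "(\<Sum>z\<leftarrow>zip u v. K (fst z) (snd z)) = (\<Sum>l<L. K (u ! l) (v ! l))"
    using len by (simp add: sum_list_sum_nth atLeast0LessThan)
  also have "\<dots> = (\<Sum>l<L. K (word (concat us) (Suc (i + l))) (word (concat vs) (Suc (j + l))))"
    using i j len by (intro sum.cong) auto
  also have "\<dots> \<le> local_max K g n (word (concat us)) (word (concat vs))"
    by (rule local_max_ge_diag[where g = g, OF g]) (use i j len in auto)
  finally show ?thesis .
qed

section \<open>High-scoring ungapped segments\<close>

locale score_words = score_model \<mu> K + iid_words M X Y \<mu>
  for \<mu> :: "'a::finite pmf" and K :: "'a \<Rightarrow> 'a \<Rightarrow> real" and M :: "'w measure"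
    and X Y :: "nat \<Rightarrow> 'w \<Rightarrow> 'a"
begin

text \<open>The length \<open>L\<close> of the blocks is \<open>k ln n\<close>.  It must be small enough for the number \<open>n / L\<close> of blocks
  to exceed \<open>exp (\<eta> L)\<close> with some \<open>\<eta> > \<theta> * drift / 2\<close>, which needs \<open>k < 1/\<eta>\<close>, and large enough
  for a typical pair to score \<open>m' L \<ge> t ln n\<close> with some \<open>m' < drift\<close>, which needs \<open>k > t/m'\<close>.
  There is room for \<open>k\<close> precisely because \<open>t < 2/\<theta>\<close>.\<close>
lemma local_max_large:
  fixes t \<epsilon> :: real
  assumes t: "0 < t" "t < 2 / \<theta>" and g: "g 0 = 0" and eps: "0 < \<epsilon>"
  shows "\<forall>\<^sub>F n in sequentially. \<forall>m. expectation (\<lambda>\<omega>.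
    of_bool (local_max K g n (\<lambda>i. X (m + i) \<omega>) (\<lambda>j. Y (m + j) \<omega>) < t * ln (real n))) \<le> \<epsilon>"
proof -
  \<comment> \<open>The factor \<open>c\<close> is the safety margin in \<open>m' = c * drift\<close> and \<open>\<eta> = \<theta> * drift / (2 * c)\<close>; then
      \<open>t/m' < 1/\<eta>\<close> amounts to \<open>t * \<theta> / 2 < c\<^sup>2\<close>.\<close>
  obtain c where c: "0 < c" "c < 1" "t * \<theta> / 2 < c\<^sup>2"
  proof
    let ?c = "sqrt ((1 + t * \<theta> / 2) / 2)"
    have a: "0 < t * \<theta> / 2" "t * \<theta> / 2 < 1" using t theta_pos by (auto simp: field_simps)
    then show "0 < ?c" "?c < 1" "t * \<theta> / 2 < ?c\<^sup>2" by auto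
  qed
  define m' where "m' = c * drift"
  define \<eta> where "\<eta> = \<theta> * drift / (2 * c)"
  have m': "0 < m'" "m' < drift" using c drift_pos by (auto simp: m'_def)
  have "\<theta> * drift / 2 * c < \<theta> * drift / 2 * 1"
    using c drift_pos theta_pos by (intro mult_strict_left_mono) auto
  then have eta: "\<theta> * drift / 2 < \<eta>" "0 < \<eta>"
    using c drift_pos theta_pos by (auto simp: \<eta>_def field_simps)
  have "t / m' < 1 / \<eta>"
    using c drift_pos theta_pos by (simp add: m'_def \<eta>_def field_simps power2_eq_square)
  then obtain k where k: "t / m' < k" "k < 1 / \<eta>" using dense by blast
  have "0 < t / m'" using t m' by simp
  then have k0: "0 < k" using k by linarith
  have k': "0 < k * m' - t" "\<eta> * k < 1" using k m' eta by (auto simp: field_simps)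
  define L where "L n = nat \<lfloor>k * ln (real n)\<rfloor>" for n :: nat
  have L_lim: "filterlim L at_top sequentially"
    unfolding L_def using k0 by real_asymp
  have "\<forall>\<^sub>F n in sequentially. \<forall>N. exp (\<eta> * real (L n)) \<le> real N \<longrightarrow>
    mean (replicate_pmf N (replicate_pmf (L n) \<mu>)) (\<lambda>us. mean (replicate_pmf N (replicate_pmf (L n) \<mu>))
      (\<lambda>vs. of_bool (\<forall>u\<in>set us. \<forall>v\<in>set vs. (\<Sum>z\<leftarrow>zip u v. \<kappa> z) < m' * real (L n)))) \<le> \<epsilon>"
    using block_pair_score_likely[OF m'(2) eta(1) eps] L_lim
    by (rule eventually_compose_filterlim)
  moreover have "\<forall>\<^sub>F n in sequentially. 0 < L n"
    by (rule eventually_compose_filterlim[OF eventually_gt_at_top L_lim])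
  moreover have "\<forall>\<^sub>F n in sequentially. exp (\<eta> * k * ln (real n)) \<le> real n / (k * ln (real n)) - 1"
    using k0 k' eta by real_asymp
  moreover have "\<forall>\<^sub>F n in sequentially. m' \<le> (k * m' - t) * ln (real n)"
    using k'(1) by real_asymp
  moreover have "\<forall>\<^sub>F n in sequentially. 1 < n" by (rule eventually_gt_at_top)
  ultimately show ?thesis
  proof eventually_elim
    case (elim n)
    let ?L = "L n"
    define N where "N = n div ?L"
    have ln: "0 < k * ln (real n)" using k0 elim by simp
    have L1: "real ?L \<le> k * ln (real n)" and L2: "k * ln (real n) - 1 < real ?L"
      using ln by (auto simp: L_def)
    have "real n / real ?L - 1 \<le> real N"
    proof -
      have "n < (N + 1) * ?L" unfolding N_def
        using elim(2) by (metis Suc_eq_plus1 dividend_less_times_div mult.commute mult_Suc_right)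
      then have "real n < (real N + 1) * real ?L" by (metis of_nat_1 of_nat_add of_nat_less_iff of_nat_mult)
      then show ?thesis using elim(2) by (simp add: field_simps)
    qed
    moreover have "real n / (k * ln (real n)) \<le> real n / real ?L"
      using L1 ln elim(2) by (intro divide_left_mono) auto
    moreover have "exp (\<eta> * real ?L) \<le> exp (\<eta> * k * ln (real n))"
      using L1 eta by (simp add: mult.assoc)
    ultimately have N: "exp (\<eta> * real ?L) \<le> real N" using elim(3) by linarith
    then have N0: "0 < N" using exp_gt_zero[of "\<eta> * real ?L"] by (cases N) auto
    have NL: "1 \<le> N * ?L" "N * ?L \<le> n" using N0 elim(2) by (simp_all add: N_def)
    have "t * ln (real n) \<le> m' * (k * ln (real n) - 1)"
      using elim(4) by (simp add: algebra_simps)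
    also have "\<dots> \<le> m' * real ?L" using L2 m' by (intro mult_left_mono) auto
    finally have tL: "t * ln (real n) \<le> m' * real ?L" .
    show ?case
    proof
      fix m
      let ?F = "\<lambda>n' x y. of_bool (local_max K g n' x y < t * ln (real n)) :: real"
      let ?X = "\<lambda>\<omega> i. X (m + i) \<omega>" and ?Y = "\<lambda>\<omega> j. Y (m + j) \<omega>"
      let ?R = "replicate_pmf N (replicate_pmf ?L \<mu>)"
      have dep: "depends_on_prefix n' (?F n')" for n'
        by (rule depends_comp[OF depends_local_max])
      note fin = finite_set_replicate_pmf[OF finite_set_replicate_pmf[OF finite_set_pmf_finite]]
      have "expectation (\<lambda>\<omega>. ?F n (?X \<omega>) (?Y \<omega>)) \<le> expectation (\<lambda>\<omega>. ?F (N * ?L) (?X \<omega>) (?Y \<omega>))"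
        using local_max_mono[OF NL, of K g]
        by (intro integral_mono[OF expectation_depends(1)[OF dep] expectation_depends(1)[OF dep]])
           (auto intro: le_less_trans)
      also have "\<dots> = mean (replicate_pmf (N * ?L) \<mu>) (\<lambda>xs. mean (replicate_pmf (N * ?L) \<mu>)
          (\<lambda>ys. ?F (N * ?L) (word xs) (word ys)))"
        by (rule expectation_depends[OF dep])
      also have "\<dots> = mean ?R (\<lambda>us. mean ?R (\<lambda>vs. ?F (N * ?L) (word (concat us)) (word (concat vs))))"
        by (simp only: mean_replicate_concat[OF finite_set_pmf_finite])
      also have "\<dots> \<le> mean ?R (\<lambda>us. mean ?R (\<lambda>vs. of_bool (\<forall>u\<in>set us. \<forall>v\<in>set vs.
          (\<Sum>z\<leftarrow>zip u v. \<kappa> z) < m' * real ?L)))"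
      proof (intro mean_mono fin)
        fix us vs assume us: "us \<in> set_pmf ?R" and vs: "vs \<in> set_pmf ?R"
        have len: "length (concat ws) = N * ?L" "\<And>w. w \<in> set ws \<Longrightarrow> length w = ?L" if "ws \<in> set_pmf ?R" for ws
        proof -
          have w: "length ws = N" "\<And>w. w \<in> set ws \<Longrightarrow> length w = ?L"
            using that by (auto simp: set_replicate_pmf)
          then have "length (concat ws) = (\<Sum>w\<leftarrow>ws. ?L)"
            unfolding length_concat by (intro arg_cong[of _ _ sum_list] map_cong) auto
          then show "length (concat ws) = N * ?L" using w(1) by (simp add: sum_list_triv)
          show "\<And>w. w \<in> set ws \<Longrightarrow> length w = ?L" by (rule w)
        qed
        have "(\<Sum>z\<leftarrow>zip u v. \<kappa> z) < m' * real ?L"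
          if "local_max K g (N * ?L) (word (concat us)) (word (concat vs)) < t * ln (real n)"
            "u \<in> set us" "v \<in> set vs" for u v
          using local_max_ge_block_pair[where g = g and K = K, OF g that(2,3) elim(2) len(2)[OF us that(2)]
              len(2)[OF vs that(3)], of "N * ?L"] len(1)[OF us] len(1)[OF vs] that(1) tL by simp
        then show "?F (N * ?L) (word (concat us)) (word (concat vs)) \<le> of_bool (\<forall>u\<in>set us. \<forall>v\<in>set vs.
          (\<Sum>z\<leftarrow>zip u v. \<kappa> z) < m' * real ?L)" by auto
      qed
      also have "\<dots> \<le> \<epsilon>" using elim(1) N by blast
      finally show "expectation (\<lambda>\<omega>. ?F n (?X \<omega>) (?Y \<omega>)) \<le> \<epsilon>" .
    qed
  qed
qed

end

section \<open>The logarithmic domain\<close>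

fun gap_weight :: "real \<Rightarrow> (nat \<Rightarrow> real) \<Rightarrow> (nat \<times> nat) list \<Rightarrow> real" where
  "gap_weight s g [] = 1"
| "gap_weight s g [p] = 1"
| "gap_weight s g (p # q # z)
    = exp (- s * g (fst q - fst p - 1)) * exp (- s * g (snd q - snd p - 1)) * gap_weight s g (q # z)"

lemma gap_weight_pos: "0 < gap_weight s g z"
  by (induction s g z rule: gap_weight.induct) auto

lemma exp_score_eq:
  "exp (s * score K g x y z) = (\<Prod>p\<leftarrow>z. exp (s * K (x (fst p)) (y (snd p)))) * gap_weight s g z"
  by (induction K g x y z rule: score.induct) (simp_all add: algebra_simps exp_diff exp_add exp_minus field_simps)

text \<open>The parameter \<open>u\<close> counts the steps between consecutive pairs, one less than the number of pairs.\<close>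
definition alignments_from :: "nat \<Rightarrow> nat \<Rightarrow> nat \<times> nat \<Rightarrow> (nat \<times> nat) list set" where
  "alignments_from n u p = {z \<in> fitting n. length z = Suc u \<and> hd z = p}"

lemma sum_gaps_le:
  fixes h :: "nat \<Rightarrow> real"
  assumes "summable h" "\<And>k. 0 \<le> h k"
  shows "(\<Sum>i'\<in>{i<..n}. h (i' - i - 1)) \<le> suminf h"
proof -
  have "(\<Sum>i'\<in>{i<..n}. h (i' - i - 1)) = (\<Sum>k<n - i. h k)"
    by (rule sum.reindex_bij_witness[of _ "\<lambda>k. k + i + 1" "\<lambda>i'. i' - i - 1"]) auto
  also have "\<dots> \<le> suminf h" using assms by (intro sum_le_suminf) auto
  finally show ?thesis .
qed

text \<open>Each further pair contributes two independent choices of a gap length, hence a factor \<open>A\<^sup>2\<close> with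
  \<open>A = \<Sum>k. exp (- s g(k))\<close>.\<close>
lemma sum_gap_weight_le:
  assumes sum: "summable (\<lambda>k. exp (- s * g k))"
  shows "(\<Sum>z\<in>alignments_from n u p. gap_weight s g z) \<le> ((\<Sum>k. exp (- s * g k))\<^sup>2) ^ u"
proof (induction u arbitrary: p)
  case 0
  have "alignments_from n 0 p \<subseteq> {[p]}"
    by (auto simp: alignments_from_def length_Suc_conv)
  then have "(\<Sum>z\<in>alignments_from n 0 p. gap_weight s g z) \<le> (\<Sum>z\<in>{[p]}. gap_weight s g z)"
    by (intro sum_mono2) auto
  then show ?case by simp
next
  case (Suc u)
  let ?A = "\<Sum>k. exp (- s * g k)"
  let ?Q = "{fst p<..n} \<times> {snd p<..n}"
  let ?h = "\<lambda>i i'. exp (- s * g (i' - i - 1))"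
  have fin: "finite (alignments_from n u q)" for q
    by (simp add: alignments_from_def finite_fitting)
  have "alignments_from n (Suc u) p \<subseteq> (\<lambda>(q, z). p # z) ` (SIGMA q:?Q. alignments_from n u q)"
  proof
    fix z assume z: "z \<in> alignments_from n (Suc u) p"
    then obtain q z' where zz: "z = p # q # z'"
      by (auto simp: alignments_from_def length_Suc_conv)
    then have "q # z' \<in> alignments_from n u q" "q \<in> ?Q"
      using z fitting_set[of z n q] by (auto simp: alignments_from_def fitting_def mem_Times_iff)
    then show "z \<in> (\<lambda>(q, z). p # z) ` (SIGMA q:?Q. alignments_from n u q)"
      unfolding zz by (intro image_eqI[of _ _ "(q, q # z')"]) auto
  qed
  then have "(\<Sum>z\<in>alignments_from n (Suc u) p. gap_weight s g z)
    \<le> (\<Sum>z\<in>(\<lambda>(q, z). p # z) ` (SIGMA q:?Q. alignments_from n u q). gap_weight s g z)"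
    by (intro sum_mono2) (auto intro!: finite_imageI finite_SigmaI fin less_imp_le[OF gap_weight_pos])
  also have "\<dots> = (\<Sum>(q, z)\<in>(SIGMA q:?Q. alignments_from n u q). gap_weight s g (p # z))"
    by (subst sum.reindex) (auto simp: inj_on_def alignments_from_def split_def)
  also have "\<dots> = (\<Sum>q\<in>?Q. \<Sum>z\<in>alignments_from n u q. gap_weight s g (p # z))"
    by (subst sum.Sigma) (auto intro!: fin)
  also have "\<dots> = (\<Sum>q\<in>?Q. ?h (fst p) (fst q) * ?h (snd p) (snd q) * (\<Sum>z\<in>alignments_from n u q. gap_weight s g z))"
    unfolding sum_distrib_left
    by (intro sum.cong refl) (auto simp: alignments_from_def length_Suc_conv)
  also have "\<dots> \<le> (\<Sum>q\<in>?Q. ?h (fst p) (fst q) * ?h (snd p) (snd q) * (?A\<^sup>2) ^ u)"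
    by (intro sum_mono mult_left_mono Suc) auto
  also have "\<dots> = (\<Sum>i'\<in>{fst p<..n}. ?h (fst p) i') * (\<Sum>j'\<in>{snd p<..n}. ?h (snd p) j') * (?A\<^sup>2) ^ u"
    unfolding sum_product sum.cartesian_product by (simp add: sum_distrib_right split_def)
  also have "\<dots> \<le> ?A * ?A * (?A\<^sup>2) ^ u"
    by (intro mult_right_mono mult_mono sum_gaps_le sum suminf_nonneg sum_nonneg) auto
  finally show ?case by (simp add: power2_eq_square)
qed

lemma sum_weight_fitting_le:
  assumes sum: "summable (\<lambda>k. exp (- s * g k))" and r: "0 \<le> r"
    "r * (\<Sum>k. exp (- s * g k))\<^sup>2 < 1"
  shows "(\<Sum>z\<in>fitting n. r ^ length z * gap_weight s g z)
    \<le> r / (1 - r * (\<Sum>k. exp (- s * g k))\<^sup>2) * (real n)\<^sup>2"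
proof -
  let ?A = "\<Sum>k. exp (- s * g k)"
  let ?T = "{..<n} \<times> ({1..n} \<times> {1..n})"
  have "(\<Sum>z\<in>fitting n. r ^ length z * gap_weight s g z)
    = (\<Sum>y\<in>?T. \<Sum>z\<in>{z \<in> fitting n. (length z - 1, hd z) = y}. r ^ length z * gap_weight s g z)"
  proof -
    have "(length z - 1, hd z) \<in> ?T" if "z \<in> fitting n" for z
    proof -
      have "z \<noteq> []" using that by (auto simp: fitting_def)
      then show ?thesis
        using fitting_set[OF that, of "hd z"] fitting_length[OF that] by (cases z) (auto simp: mem_Times_iff)
    qed
    then have "(\<lambda>z. (length z - 1, hd z)) ` fitting n \<subseteq> ?T" by blast
    then show ?thesis by (intro sum.group[symmetric] finite_fitting) simp
  qed
  also have "\<dots> \<le> (\<Sum>y\<in>?T. r * (r * ?A\<^sup>2) ^ fst y)"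
  proof (rule sum_mono)
    fix y :: "nat \<times> nat \<times> nat"
    obtain u i j where y: "y = (u, (i, j))" by (cases y)
    have "(\<Sum>z\<in>{z \<in> fitting n. (length z - 1, hd z) = (u, (i, j))}. r ^ length z * gap_weight s g z)
      = r ^ Suc u * (\<Sum>z\<in>alignments_from n u (i, j). gap_weight s g z)"
      unfolding sum_distrib_left
    proof (rule sum.cong)
      have "length z = Suc (length z - 1)" if "z \<in> fitting n" for z
        using that by (cases z) (auto simp: fitting_def)
      then show "{z \<in> fitting n. (length z - 1, hd z) = (u, (i, j))} = alignments_from n u (i, j)"
        by (auto simp: alignments_from_def)
    qed (auto simp: alignments_from_def)
    also have "\<dots> \<le> r ^ Suc u * (?A\<^sup>2) ^ u"
      using r by (intro mult_left_mono sum_gap_weight_le sum) auto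
    also have "\<dots> = r * (r * ?A\<^sup>2) ^ u" by (simp add: power_mult_distrib)
    finally show "(\<Sum>z\<in>{z \<in> fitting n. (length z - 1, hd z) = y}. r ^ length z * gap_weight s g z)
      \<le> r * (r * ?A\<^sup>2) ^ fst y" by (simp add: y)
  qed
  also have "\<dots> = (\<Sum>u<n. (real n)\<^sup>2 * r * (r * ?A\<^sup>2) ^ u)"
    unfolding sum.cartesian_product' by (simp add: power2_eq_square mult.assoc)
  also have "\<dots> = (real n)\<^sup>2 * r * (\<Sum>u<n. (r * ?A\<^sup>2) ^ u)" by (simp add: sum_distrib_left)
  also have "\<dots> \<le> (real n)\<^sup>2 * r * (\<Sum>u. (r * ?A\<^sup>2) ^ u)"
    using r by (intro mult_left_mono sum_le_suminf summable_geometric) auto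
  also have "(\<Sum>u. (r * ?A\<^sup>2) ^ u) = 1 / (1 - r * ?A\<^sup>2)"
    using r by (intro suminf_geometric) auto
  finally show ?thesis by (simp add: mult.commute)
qed

context score_words
begin

lemma expectation_exp_score:
  assumes z: "z \<in> alignments"
  shows "integrable M (\<lambda>\<omega>. exp (s * score K g (\<lambda>i. X i \<omega>) (\<lambda>j. Y j \<omega>) z))"
    and "expectation (\<lambda>\<omega>. exp (s * score K g (\<lambda>i. X i \<omega>) (\<lambda>j. Y j \<omega>) z))
      = mgf s ^ length z * gap_weight s g z"
proof -
  let ?F = "\<lambda>xs ys. (\<Prod>w\<leftarrow>zip xs ys. exp (s * \<kappa> w)) * gap_weight s g z"
  have eq: "exp (s * score K g (\<lambda>i. X i \<omega>) (\<lambda>j. Y j \<omega>) z)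
    = ?F (map (\<lambda>i. X i \<omega>) (map fst z)) (map (\<lambda>j. Y j \<omega>) (map snd z))" for \<omega>
    unfolding exp_score_eq by (simp add: zip_map_map zip_same_conv_map o_def)
  have d: "distinct (map fst z)" "distinct (map snd z)" "\<forall>i\<in>set (map fst z). 1 \<le> i" "\<forall>j\<in>set (map snd z). 1 \<le> j"
    using alignment_bounds[OF z] by fastforce+
  show "integrable M (\<lambda>\<omega>. exp (s * score K g (\<lambda>i. X i \<omega>) (\<lambda>j. Y j \<omega>) z))"
    unfolding eq by (rule expectation_letters(1)[OF d])
  show "expectation (\<lambda>\<omega>. exp (s * score K g (\<lambda>i. X i \<omega>) (\<lambda>j. Y j \<omega>) z)) = mgf s ^ length z * gap_weight s g z"
    unfolding eq
    by (rule trans[OF expectation_letters(2)[OF d, of ?F]])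
       (simp add: mean_replicate_zip[OF finite_set_pmf_finite finite_set_pmf_finite, of _ _ _ "\<lambda>ws. \<Prod>w\<leftarrow>ws. exp (s * \<kappa> w)"]
          mean_replicate_prod mgf_def)
qed

lemma integrable_local_max:
  fixes f :: "real \<Rightarrow> real"
  shows "integrable M (\<lambda>\<omega>. f (local_max K g n (\<lambda>i. X i \<omega>) (\<lambda>j. Y j \<omega>)))"
  using expectation_depends(1)[OF depends_comp[OF depends_local_max[of n K g], of f], of 0] by simp

text \<open>Markov's inequality for the sum of \<open>exp (s S)\<close> over all fitting alignments.  The factor \<open>n\<^sup>2\<close> counts
  the possible first pairs.\<close>
lemma local_max_tail:
  assumes s: "0 < s" and sum: "summable (\<lambda>k. exp (- s * g k))"
    and small: "mgf s * (\<Sum>k. exp (- s * g k))\<^sup>2 < 1" and n: "1 \<le> n"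
  shows "expectation (\<lambda>\<omega>. of_bool (c \<le> local_max K g n (\<lambda>i. X i \<omega>) (\<lambda>j. Y j \<omega>)))
    \<le> mgf s / (1 - mgf s * (\<Sum>k. exp (- s * g k))\<^sup>2) * (real n)\<^sup>2 * exp (- s * c)"
proof -
  let ?S = "\<lambda>\<omega>. score K g (\<lambda>i. X i \<omega>) (\<lambda>j. Y j \<omega>)"
  have al: "z \<in> alignments" if "z \<in> fitting n" for z using that by (simp add: fitting_def)
  note ex = expectation_exp_score[OF al, where s = s and g = g]
  have "expectation (\<lambda>\<omega>. of_bool (c \<le> local_max K g n (\<lambda>i. X i \<omega>) (\<lambda>j. Y j \<omega>)))
    \<le> expectation (\<lambda>\<omega>. \<Sum>z\<in>fitting n. exp (s * ?S \<omega> z) * exp (- s * c))"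
  proof (rule integral_mono)
    show "integrable M (\<lambda>\<omega>. of_bool (c \<le> local_max K g n (\<lambda>i. X i \<omega>) (\<lambda>j. Y j \<omega>)) :: real)"
      by (rule integrable_local_max)
    show "integrable M (\<lambda>\<omega>. \<Sum>z\<in>fitting n. exp (s * ?S \<omega> z) * exp (- s * c))"
      by (intro Bochner_Integration.integrable_sum integrable_mult_left ex(1))
    fix \<omega>
    show "of_bool (c \<le> local_max K g n (\<lambda>i. X i \<omega>) (\<lambda>j. Y j \<omega>)) \<le> (\<Sum>z\<in>fitting n. exp (s * ?S \<omega> z) * exp (- s * c))"
    proof (cases "c \<le> local_max K g n (\<lambda>i. X i \<omega>) (\<lambda>j. Y j \<omega>)")
      case True
      then obtain z where z: "z \<in> fitting n" "c \<le> ?S \<omega> z" using local_max_ge_iff[OF n] by blast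
      have "1 \<le> exp (s * ?S \<omega> z) * exp (- s * c)"
        using z(2) s by (simp flip: exp_add)
      also have "\<dots> \<le> (\<Sum>z\<in>fitting n. exp (s * ?S \<omega> z) * exp (- s * c))"
        using z(1) by (intro member_le_sum finite_fitting) auto
      finally show ?thesis by simp
    qed (simp add: sum_nonneg)
  qed
  also have "\<dots> = (\<Sum>z\<in>fitting n. mgf s ^ length z * gap_weight s g z) * exp (- s * c)"
    using ex by (simp add: sum_distrib_right)
  also have "\<dots> \<le> mgf s / (1 - mgf s * (\<Sum>k. exp (- s * g k))\<^sup>2) * (real n)\<^sup>2 * exp (- s * c)"
    by (intro mult_right_mono sum_weight_fitting_le sum small) (auto simp: mgf_def)
  finally show ?thesis .
qed

lemma prob_eq_expectation_of_bool: "prob {\<omega> \<in> space M. P \<omega>} = expectation (\<lambda>\<omega>. of_bool (P \<omega>))"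
proof -
  have "expectation (\<lambda>\<omega>. of_bool (P \<omega>)) = expectation (indicator {\<omega>. P \<omega>})"
    by (rule Bochner_Integration.integral_cong) (auto simp: indicator_def)
  also have "\<dots> = prob ({\<omega>. P \<omega>} \<inter> space M)"
    by (rule Bochner_Integration.integral_indicator)
  also have "{\<omega>. P \<omega>} \<inter> space M = {\<omega> \<in> space M. P \<omega>}" by auto
  finally show ?thesis by simp
qed

lemma logarithmic_domainI:
  assumes g: "g 0 = 0" and s: "0 < s" "s < \<theta>" and sum: "summable (\<lambda>k. exp (- s * g k))"
    and small: "mgf s * (\<Sum>k. exp (- s * g k))\<^sup>2 < 1"
  shows "logarithmic_domain M X Y K g"
proof -
  let ?H = "\<lambda>n \<omega>. local_max K g n (\<lambda>i. X i \<omega>) (\<lambda>j. Y j \<omega>)"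
  \<comment> \<open>Any \<open>t < 2/\<theta>\<close> and \<open>\<tau>1 < t\<close> would do; \<open>\<tau>2 = 3/s\<close> turns the tail bound
      \<open>O(n\<^sup>2 exp (- s \<tau>2 ln n))\<close> into \<open>O(1/n)\<close>.\<close>
  define t where "t = 1 / \<theta>"
  define \<tau>1 where "\<tau>1 = t / 2"
  define \<tau>2 where "\<tau>2 = 3 / s"
  have t: "0 < t" "t < 2 / \<theta>" using theta_pos by (auto simp: t_def field_simps)
  have "1 / \<theta> < 1 / s" using s by (simp add: frac_less2)
  then have tau: "0 < \<tau>1" "\<tau>1 < t" "\<tau>1 < \<tau>2"
    using t s by (auto simp: \<tau>1_def \<tau>2_def t_def)
  define C where "C = mgf s / (1 - mgf s * (\<Sum>k. exp (- s * g k))\<^sup>2)"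
  let ?good = "\<lambda>n \<omega>. \<tau>1 < real_of_ereal (H_score K g (\<lambda>i. X i \<omega>) n (\<lambda>j. Y j \<omega>) n) / ln (real n) \<and>
      real_of_ereal (H_score K g (\<lambda>i. X i \<omega>) n (\<lambda>j. Y j \<omega>) n) / ln (real n) < \<tau>2"
  have "(\<lambda>n. prob {\<omega> \<in> space M. ?good n \<omega>}) \<longlonglongrightarrow> 1"
  proof (rule order_tendstoI)
    fix a :: real assume "1 < a"
    then show "\<forall>\<^sub>F n in sequentially. prob {\<omega> \<in> space M. ?good n \<omega>} < a"
      by (intro always_eventually allI le_less_trans[OF prob_le_1])
  next
    fix a :: real assume a: "a < 1"
    define \<epsilon> where "\<epsilon> = (1 - a) / 2"
    have eps: "0 < \<epsilon>" "a = 1 - (\<epsilon> + \<epsilon>)" using a by (simp_all add: \<epsilon>_def)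
    have "\<forall>\<^sub>F n in sequentially. C * (real n)\<^sup>2 * exp (- s * (\<tau>2 * ln (real n))) < \<epsilon>"
    proof (rule order_tendstoD)
      have "(\<lambda>n. (real n)\<^sup>2 * exp (- 3 * ln (real n))) \<longlonglongrightarrow> 0" by real_asymp
      then have "(\<lambda>n. C * ((real n)\<^sup>2 * exp (- 3 * ln (real n)))) \<longlonglongrightarrow> 0"
        by (rule tendsto_mult_right_zero)
      moreover have "s * \<tau>2 = 3" using s by (simp add: \<tau>2_def)
      then have "- s * (\<tau>2 * ln (real n)) = - 3 * ln (real n)" for n
        by (simp flip: mult.assoc)
      ultimately show "(\<lambda>n. C * (real n)\<^sup>2 * exp (- s * (\<tau>2 * ln (real n)))) \<longlonglongrightarrow> 0"
        by (simp only: mult.assoc)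
    qed (rule eps)
    moreover note local_max_large[where g = g, OF t g eps(1)]
    moreover have "\<forall>\<^sub>F n in sequentially. 1 < n" by (rule eventually_gt_at_top)
    ultimately show "\<forall>\<^sub>F n in sequentially. a < prob {\<omega> \<in> space M. ?good n \<omega>}"
    proof eventually_elim
      case (elim n)
      then have n: "1 \<le> n" "0 < ln (real n)" by auto
      let ?low = "\<lambda>\<omega>. of_bool (?H n \<omega> < t * ln (real n)) :: real"
      let ?up = "\<lambda>\<omega>. of_bool (\<tau>2 * ln (real n) \<le> ?H n \<omega>) :: real"
      let ?mid = "\<lambda>\<omega>. of_bool (\<tau>1 < ?H n \<omega> / ln (real n) \<and> ?H n \<omega> / ln (real n) < \<tau>2) :: real"
      have int: "integrable M (\<lambda>\<omega>. f (?H n \<omega>))" for f :: "real \<Rightarrow> real"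
        by (rule integrable_local_max)
      have low: "expectation ?low \<le> \<epsilon>" using elim(2)[rule_format, of 0] by simp
      have up: "expectation ?up < \<epsilon>"
        using local_max_tail[OF s(1) sum small n(1), of "\<tau>2 * ln (real n)"] elim(1) unfolding C_def by simp
      have "1 - (expectation ?low + expectation ?up) = expectation (\<lambda>\<omega>. 1 - (?low \<omega> + ?up \<omega>))"
        using int[of "\<lambda>h. of_bool (h < t * ln (real n))"] int[of "\<lambda>h. of_bool (\<tau>2 * ln (real n) \<le> h)"]
        by (subst Bochner_Integration.integral_diff, simp_all only: integrable_const Bochner_Integration.integrable_add
             Bochner_Integration.integral_add lebesgue_integral_const prob_space scaleR_one)
      also have "\<dots> \<le> expectation ?mid"
      proof (rule integral_mono)
        show "integrable M (\<lambda>\<omega>. 1 - (?low \<omega> + ?up \<omega>))"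
          by (rule int[of "\<lambda>h. 1 - (of_bool (h < t * ln (real n)) + of_bool (\<tau>2 * ln (real n) \<le> h))"])
        show "integrable M ?mid"
          by (rule int[of "\<lambda>h. of_bool (\<tau>1 < h / ln (real n) \<and> h / ln (real n) < \<tau>2)"])
        fix \<omega>
        have "\<tau>1 < ?H n \<omega> / ln (real n)" if "t * ln (real n) \<le> ?H n \<omega>"
        proof -
          have "t \<le> ?H n \<omega> / ln (real n)" using that n by (simp add: field_simps)
          then show ?thesis using tau(2) by simp
        qed
        moreover have "?H n \<omega> / ln (real n) < \<tau>2" if "\<not> \<tau>2 * ln (real n) \<le> ?H n \<omega>"
          using that n by (simp add: field_simps)
        ultimately show "1 - (?low \<omega> + ?up \<omega>) \<le> ?mid \<omega>" by (auto simp: not_less)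
      qed
      also have "\<dots> = prob {\<omega> \<in> space M. ?good n \<omega>}"
        unfolding prob_eq_expectation_of_bool H_score_eq[OF n(1)] ..
      finally show ?case using low up eps(2) by linarith
    qed
  qed
  then show ?thesis unfolding logarithmic_domain_def using tau by blast
qed

text \<open>Since \<open>\<Sum>k. exp (- s g(k)) = 1 + exp (- s \<Delta>) A\<close>, the ratio of the geometric series in the union
  bound tends to \<open>mgf s < 1\<close> as \<open>\<Delta>\<close> grows.\<close>
lemma logarithmic_domain_gap:
  assumes \<gamma>: "\<And>k. 1 \<le> k \<Longrightarrow> 0 \<le> \<gamma> k" and s: "s < \<theta>"
    and sum: "summable (\<lambda>k. exp (- s * \<gamma> (Suc k)))"
  shows "\<exists>\<Delta>\<^sub>0. \<forall>\<Delta>\<ge>\<Delta>\<^sub>0. logarithmic_domain M X Y K (gap \<Delta> \<gamma>)"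
proof -
  \<comment> \<open>For \<open>s \<le> 0\<close> all terms of the series are at least \<open>1\<close>.\<close>
  have s0: "0 < s"
  proof (rule ccontr)
    assume "\<not> 0 < s"
    then have "1 \<le> exp (- s * \<gamma> (Suc k))" for k
      using \<gamma>[of "Suc k"] by (simp add: mult_nonpos_nonneg)
    moreover have "\<forall>\<^sub>F k in sequentially. exp (- s * \<gamma> (Suc k)) < 1"
      using summable_LIMSEQ_zero[OF sum] by (rule order_tendstoD) simp
    ultimately show False by (simp add: not_less[symmetric])
  qed
  define A where "A = (\<Sum>k. exp (- s * \<gamma> (Suc k)))"
  have A: "summable (\<lambda>k. exp (- s * gap \<Delta> \<gamma> k))"
    "(\<Sum>k. exp (- s * gap \<Delta> \<gamma> k)) = 1 + exp (- s * \<Delta>) * A" for \<Delta>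
  proof -
    have eq: "exp (- s * gap \<Delta> \<gamma> (Suc k)) = exp (- s * \<Delta>) * exp (- s * \<gamma> (Suc k))" for k
      by (simp add: gap_def distrib_left exp_add[symmetric] exp_diff[symmetric])
    have sum': "summable (\<lambda>k. exp (- s * gap \<Delta> \<gamma> (Suc k)))"
      unfolding eq using sum by (rule summable_mult)
    then show *: "summable (\<lambda>k. exp (- s * gap \<Delta> \<gamma> k))"
      using summable_Suc_iff[of "\<lambda>k. exp (- s * gap \<Delta> \<gamma> k)"] by blast
    have "(\<Sum>k. exp (- s * gap \<Delta> \<gamma> (Suc k))) = exp (- s * \<Delta>) * A"
      unfolding eq A_def using sum by (rule suminf_mult)
    then show "(\<Sum>k. exp (- s * gap \<Delta> \<gamma> k)) = 1 + exp (- s * \<Delta>) * A"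
      using suminf_split_head[OF *] by (simp add: gap_def)
  qed
  have "((\<lambda>\<Delta>. exp (- s * \<Delta>)) \<longlongrightarrow> 0) at_top" using s0 by real_asymp
  then have "((\<lambda>\<Delta>. mgf s * (1 + exp (- s * \<Delta>) * A)\<^sup>2) \<longlongrightarrow> mgf s * (1 + 0 * A)\<^sup>2) at_top"
    by (intro tendsto_intros)
  then have "\<forall>\<^sub>F \<Delta> in at_top. mgf s * (1 + exp (- s * \<Delta>) * A)\<^sup>2 < 1"
    using mgf_less_one[OF s0 s] by (intro order_tendstoD) auto
  then obtain \<Delta>\<^sub>0 where D: "\<And>\<Delta>. \<Delta>\<^sub>0 \<le> \<Delta> \<Longrightarrow> mgf s * (1 + exp (- s * \<Delta>) * A)\<^sup>2 < 1"
    unfolding eventually_at_top_linorder by blast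
  have "logarithmic_domain M X Y K (gap \<Delta> \<gamma>)" if "\<Delta>\<^sub>0 \<le> \<Delta>" for \<Delta>
  proof (rule logarithmic_domainI[OF _ s0 s A(1)])
    show "mgf s * (\<Sum>k. exp (- s * gap \<Delta> \<gamma> k))\<^sup>2 < 1" unfolding A(2) by (rule D[OF that])
  qed (simp add: gap_def)
  then show ?thesis by blast
qed

end

section \<open>The linear domain\<close>

text \<open>Fekete's lemma.  The limit is the supremum of the ratios, so it is positive as soon as one term
  of the sequence is.\<close>
lemma superadditive_limit:
  fixes a :: "nat \<Rightarrow> real"
  assumes super: "\<And>m n. a m + a n \<le> a (m + n)" and bound: "\<And>n. a n \<le> C * real n"
  shows "\<exists>l. (\<lambda>n. a n / real n) \<longlonglongrightarrow> l \<and> (\<forall>n\<ge>1. a n / real n \<le> l)"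
proof -
  define l where "l = (SUP n\<in>{1..}. a n / real n)"
  have bdd: "bdd_above ((\<lambda>n. a n / real n) ` {1..})"
    by (rule bdd_aboveI2[of _ _ C]) (use bound in \<open>auto simp: field_simps\<close>)
  have le: "a n / real n \<le> l" if "1 \<le> n" for n
    unfolding l_def using that by (intro cSUP_upper bdd) auto
  have "(\<lambda>n. a n / real n) \<longlonglongrightarrow> l"
  proof (rule order_tendstoI)
    fix b assume "l < b"
    then show "\<forall>\<^sub>F n in sequentially. a n / real n < b"
      using le by (intro eventually_sequentiallyI[of 1]) (auto intro: le_less_trans)
  next
    fix b assume "b < l"
    then obtain k where k: "1 \<le> k" "b < a k / real k"
      using less_cSUP_iff[of "{1..}" "\<lambda>n. a n / real n" b, OF _ bdd] unfolding l_def by blast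
    define c where "c = a k / real k"
    define B where "B = (\<Sum>r<k. \<bar>a r\<bar>)"
    have mult: "real q * a k + a r \<le> a (q * k + r)" for q r
    proof (induction q)
      case (Suc q)
      then show ?case using super[of k "q * k + r"] by (simp add: algebra_simps)
    qed simp
    have lower: "c - (real k * \<bar>c\<bar> + B) / real n \<le> a n / real n" if "1 \<le> n" for n
    proof -
      have r: "n mod k < k" using k by simp
      have "a (n mod k) \<ge> - \<bar>a (n mod k)\<bar>" by simp
      moreover have "\<bar>a (n mod k)\<bar> \<le> B"
        unfolding B_def using r by (intro member_le_sum[of "n mod k" _ "\<lambda>r. \<bar>a r\<bar>"]) auto
      moreover have "real (n div k) * a k = (real n - real (n mod k)) * c"
      proof -
        have "real n = real (n div k) * real k + real (n mod k)"
          by (metis div_mult_mod_eq of_nat_add of_nat_mult)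
        then show ?thesis using k by (simp add: c_def)
      qed
      moreover have "real (n mod k) * c \<le> real k * \<bar>c\<bar>"
      proof -
        have "real (n mod k) * c \<le> real (n mod k) * \<bar>c\<bar>" by (intro mult_left_mono) auto
        also have "\<dots> \<le> real k * \<bar>c\<bar>" using r by (intro mult_right_mono) auto
        finally show ?thesis .
      qed
      ultimately have "real n * c - (real k * \<bar>c\<bar> + B) \<le> a n"
        using mult[of "n div k" "n mod k"] by (simp add: algebra_simps)
      then have "(real n * c - (real k * \<bar>c\<bar> + B)) / real n \<le> a n / real n"
        by (rule divide_right_mono) simp
      then show ?thesis using that by (simp add: diff_divide_distrib)
    qed
    have "(\<lambda>n. c - (real k * \<bar>c\<bar> + B) / real n) \<longlonglongrightarrow> c" by real_asymp
    then have "\<forall>\<^sub>F n in sequentially. b < c - (real k * \<bar>c\<bar> + B) / real n"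
      using k(2) unfolding c_def[symmetric] by (rule order_tendstoD)
    then show "\<forall>\<^sub>F n in sequentially. b < a n / real n"
      using eventually_ge_at_top[of 1] by eventually_elim (use lower in \<open>auto intro: less_le_trans\<close>)
  qed
  then show ?thesis using le by blast
qed

text \<open>Subadditivity holds because the increments of \<open>g\<close> decrease and \<open>g 0 = 0\<close>.\<close>
lemma gap_penaltyD:
  assumes "gap_penalty g"
  shows "g 0 = 0" "0 \<le> g k" "i \<le> j \<Longrightarrow> g i \<le> g j" "g (i + j) \<le> g i + g j"
proof -
  show "g 0 = 0" "0 \<le> g k" "i \<le> j \<Longrightarrow> g i \<le> g j"
    using assms by (auto simp: gap_penalty_def mono_def)
  have "g (Suc (Suc k)) - g (Suc k) \<le> g (Suc k) - g k" for k
    using assms unfolding gap_penalty_def by (metis Suc_eq_plus1 diff_Suc_1 le_add2)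
  then have "antimono (\<lambda>k. g (Suc k) - g k)"
    unfolding antimono_iff_le_Suc by blast
  then have d: "g (Suc (i + j)) - g (i + j) \<le> g (Suc j) - g j" for j
    by (rule antimonoD) simp
  show "g (i + j) \<le> g i + g j"
  proof (induction j)
    case 0
    then show ?case using \<open>g 0 = 0\<close> by simp
  next
    case (Suc j)
    then show ?case using d[of j] by simp
  qed
qed

lemma score_le:
  assumes "\<And>k. 0 \<le> g k" "\<And>a b. K a b \<le> C"
  shows "score K g x y z \<le> C * real (length z)"
proof (induction z rule: induct_list012)
  case (2 p)
  then show ?case using assms by simp
next
  case (3 p q z)
  have "score K g x y (p # q # z) \<le> C + score K g x y (q # z)"
    using assms(1)[of "fst q - fst p - 1"] assms(1)[of "snd q - snd p - 1"]
      assms(2)[of "x (fst p)" "y (snd p)"] by simp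
  then show ?case using 3 by (simp add: algebra_simps)
qed simp

lemma score_append_fitting:
  assumes z: "z \<in> fitting m" and z': "z' \<in> fitting n"
  shows "z @ shift m z' \<in> fitting (m + n)"
    and "score K g x y (z @ shift m z')
      = score K g x y z + score K g (\<lambda>i. x (m + i)) (\<lambda>j. y (m + j)) z'
        - (g ((m - fst (last z)) + (fst (hd z') - 1)) + g ((m - snd (last z)) + (snd (hd z') - 1)))"
    and "hd (z @ shift m z') = hd z"
    and "last (z @ shift m z') = (m + fst (last z'), m + snd (last z'))"
proof -
  have ne: "z \<noteq> []" "z' \<noteq> []" using z z' by (auto simp: fitting_def)
  have b: "fst (hd z') \<ge> 1" "snd (hd z') \<ge> 1" "fst (last z) \<le> m" "snd (last z) \<le> m"
    using fitting_set[OF z', of "hd z'"] z ne by (auto simp: fitting_def)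
  show "z @ shift m z' \<in> fitting (m + n)"
    using z z' b ne by (auto simp: fitting_def shift_in_alignments intro!: alignments_append)
  show "score K g x y (z @ shift m z')
      = score K g x y z + score K g (\<lambda>i. x (m + i)) (\<lambda>j. y (m + j)) z'
        - (g ((m - fst (last z)) + (fst (hd z') - 1)) + g ((m - snd (last z)) + (snd (hd z') - 1)))"
    using b ne by (simp add: score_append score_shift)
  show "hd (z @ shift m z') = hd z" "last (z @ shift m z') = (m + fst (last z'), m + snd (last z'))"
    using ne by simp_all
qed

text \<open>Two optimal global alignments can be placed one after the other.  The two edges that meet merge
  into one gap, which by subadditivity costs no more than both of them.\<close>
lemma global_max_superadditive:
  assumes g: "gap_penalty g" and "1 \<le> m" "1 \<le> n"
  shows "global_max K g m x y + global_max K g n (\<lambda>i. x (m + i)) (\<lambda>j. y (m + j))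
    \<le> global_max K g (m + n) x y"
proof -
  obtain z where z: "z \<in> fitting m" "global_max K g m x y \<le> score K g x y z - edge_cost g m z"
    using global_max_ge_iff[OF assms(2)] by blast
  obtain z' where z': "z' \<in> fitting n" "global_max K g n (\<lambda>i. x (m + i)) (\<lambda>j. y (m + j))
      \<le> score K g (\<lambda>i. x (m + i)) (\<lambda>j. y (m + j)) z' - edge_cost g n z'"
    using global_max_ge_iff[OF assms(3)] by blast
  note app = score_append_fitting[OF z(1) z'(1)]
  have "edge_cost g (m + n) (z @ shift m z')
    = g (fst (hd z) - 1) + g (snd (hd z) - 1) + g (n - fst (last z')) + g (n - snd (last z'))"
    unfolding edge_cost_def app(3,4) by simp
  then have "global_max K g m x y + global_max K g n (\<lambda>i. x (m + i)) (\<lambda>j. y (m + j))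
    \<le> score K g x y (z @ shift m z') - edge_cost g (m + n) (z @ shift m z')"
    using z(2) z'(2) gap_penaltyD(4)[OF g, of "m - fst (last z)" "fst (hd z') - 1"]
      gap_penaltyD(4)[OF g, of "m - snd (last z)" "snd (hd z') - 1"]
    unfolding app(2) by (simp add: edge_cost_def)
  then show ?thesis using app(1) assms by (subst global_max_ge_iff) auto
qed

text \<open>The best local alignments of consecutive blocks of length \<open>n\<close> can be joined.  A gap between
  neighbouring blocks has length at most \<open>2n\<close> because an alignment starts within its first \<open>n\<close>
  letters and ends within \<open>n\<close> letters of the end; the induction has to carry both facts along, and
  they also bound the edges of the resulting global alignment.\<close>
lemma chain_blocks:
  assumes g: "gap_penalty g" and n: "1 \<le> n"
  shows "\<exists>z\<in>fitting (Suc B * n). fst (hd z) \<le> n \<and> snd (hd z) \<le> n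
      \<and> B * n \<le> fst (last z) \<and> B * n \<le> snd (last z)
      \<and> (\<Sum>b\<le>B. local_max K g n (\<lambda>i. x (b * n + i)) (\<lambda>j. y (b * n + j))) - 2 * real B * g (2 * n)
        \<le> score K g x y z"
proof (induction B)
  case 0
  obtain z where z: "z \<in> fitting n" "local_max K g n x y \<le> score K g x y z"
    using local_max_ge_iff[OF n] by blast
  then have "z \<noteq> []" by (auto simp: fitting_def)
  then show ?case using z fitting_set[OF z(1), of "hd z"] by auto
next
  case (Suc B)
  let ?m = "Suc B * n"
  from Suc obtain z where z: "z \<in> fitting ?m" "fst (hd z) \<le> n" "snd (hd z) \<le> n"
    "B * n \<le> fst (last z)" "B * n \<le> snd (last z)"
    "(\<Sum>b\<le>B. local_max K g n (\<lambda>i. x (b * n + i)) (\<lambda>j. y (b * n + j))) - 2 * real B * g (2 * n)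
        \<le> score K g x y z" by auto
  obtain z' where z': "z' \<in> fitting n" "local_max K g n (\<lambda>i. x (?m + i)) (\<lambda>j. y (?m + j))
      \<le> score K g (\<lambda>i. x (?m + i)) (\<lambda>j. y (?m + j)) z'"
    using local_max_ge_iff[OF n] by blast
  note app = score_append_fitting[OF z(1) z'(1)]
  have "z' \<noteq> []" using z'(1) by (auto simp: fitting_def)
  then have "fst (hd z') \<le> n" "snd (hd z') \<le> n" using fitting_set[OF z'(1), of "hd z'"] by auto
  then have "g ((?m - fst (last z)) + (fst (hd z') - 1)) \<le> g (2 * n)"
    "g ((?m - snd (last z)) + (snd (hd z') - 1)) \<le> g (2 * n)"
    using z(4,5) by (auto intro!: gap_penaltyD(3)[OF g])
  then have "(\<Sum>b\<le>Suc B. local_max K g n (\<lambda>i. x (b * n + i)) (\<lambda>j. y (b * n + j)))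
      - 2 * real (Suc B) * g (2 * n) \<le> score K g x y (z @ shift ?m z')"
    using z(6) z'(2) unfolding app(2) by (simp add: algebra_simps)
  moreover have "z @ shift ?m z' \<in> fitting (Suc (Suc B) * n)"
    using app(1) by (simp add: add.commute)
  ultimately show ?case using z(2,3) app(3,4) by (intro bexI[of _ "z @ shift ?m z'"]) auto
qed

context score_words
begin

lemma K_bounded: "\<exists>C>0. \<forall>a b. \<bar>K a b\<bar> \<le> C"
proof -
  let ?R = "range (\<lambda>z. \<bar>\<kappa> z\<bar>)"
  have "\<bar>K a b\<bar> \<le> Max ?R" for a b
    using Max_ge[OF finite_imageI[OF finite] rangeI[of "\<lambda>z. \<bar>\<kappa> z\<bar>" "(a, b)"]] by simp
  then have "\<bar>K a b\<bar> \<le> max 1 (Max ?R)" for a b by (simp add: le_max_iff_disj)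
  then show ?thesis by (intro exI[of _ "max 1 (Max ?R)"]) auto
qed

text \<open>With \<open>B + 1\<close> blocks the mean gain is \<open>B + 1\<close> times that of one block, against \<open>2 B\<close> gaps and four
  edges costing at most \<open>g (2 * n)\<close> each.  If a block gains more than two gaps cost, the balance is
  positive for large \<open>B\<close>.\<close>
lemma linear_domainI:
  assumes g: "gap_penalty g" and n: "1 \<le> n"
    and gain: "2 * g (2 * n) < expectation (\<lambda>\<omega>. local_max K g n (\<lambda>i. X i \<omega>) (\<lambda>j. Y j \<omega>))"
  shows "linear_domain M X Y K g"
proof -
  define e where "e = expectation (\<lambda>\<omega>. local_max K g n (\<lambda>i. X i \<omega>) (\<lambda>j. Y j \<omega>))"
  define a where "a n = (if n = 0 then 0 else expectation (\<lambda>\<omega>. global_max K g n (\<lambda>i. X i \<omega>) (\<lambda>j. Y j \<omega>)))" for n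
  obtain C where C: "0 < C" "\<And>a b. \<bar>K a b\<bar> \<le> C" using K_bounded by blast
  have intG: "integrable M (\<lambda>\<omega>. global_max K g n (\<lambda>i. X (m + i) \<omega>) (\<lambda>j. Y (m + j) \<omega>))"
    and intL: "integrable M (\<lambda>\<omega>. local_max K g n (\<lambda>i. X (m + i) \<omega>) (\<lambda>j. Y (m + j) \<omega>))" for m n
    by (rule expectation_depends(1)[OF depends_global_max] expectation_depends(1)[OF depends_local_max])+
  have statG: "expectation (\<lambda>\<omega>. global_max K g n (\<lambda>i. X (m + i) \<omega>) (\<lambda>j. Y (m + j) \<omega>)) = a n"
    if "n \<noteq> 0" for m n
    using expectation_depends(2)[OF depends_global_max, of K g n m]
      expectation_depends(2)[OF depends_global_max, of K g n 0] that by (simp add: a_def)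
  have statL: "expectation (\<lambda>\<omega>. local_max K g n (\<lambda>i. X (m + i) \<omega>) (\<lambda>j. Y (m + j) \<omega>)) = e" for m
    using expectation_depends(2)[OF depends_local_max, of K g n m]
      expectation_depends(2)[OF depends_local_max, of K g n 0] by (simp add: e_def)
  have super: "a m + a k \<le> a (m + k)" for m k
  proof (cases "m = 0 \<or> k = 0")
    case False
    have "a m + a k = expectation (\<lambda>\<omega>. global_max K g m (\<lambda>i. X i \<omega>) (\<lambda>j. Y j \<omega>)
        + global_max K g k (\<lambda>i. X (m + i) \<omega>) (\<lambda>j. Y (m + j) \<omega>))"
      using False statG[of m 0] statG[of k m] intG[of m 0] intG[of k m] by simp
    also have "\<dots> \<le> expectation (\<lambda>\<omega>. global_max K g (m + k) (\<lambda>i. X i \<omega>) (\<lambda>j. Y j \<omega>))"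
      using False intG[of m 0] intG[of k m] intG[of "m + k" 0]
      by (intro integral_mono Bochner_Integration.integrable_add global_max_superadditive[OF g]) auto
    finally show ?thesis using False by (simp add: a_def)
  qed (auto simp: a_def)
  have bound: "a k \<le> C * real k" for k
  proof (cases "k = 0")
    case False
    have "global_max K g k x y \<le> C * real k" for x y
    proof -
      obtain z where z: "z \<in> fitting k" "global_max K g k x y \<le> score K g x y z - edge_cost g k z"
        using global_max_ge_iff[of k _ K g x y] False by auto
      have "0 \<le> edge_cost g k z" unfolding edge_cost_def by (intro add_nonneg_nonneg gap_penaltyD(2)[OF g])
      moreover have "score K g x y z \<le> C * real (length z)"
        using C(2) by (intro score_le gap_penaltyD(2)[OF g]) (auto simp: abs_le_iff)
      moreover have "\<dots> \<le> C * real k" using fitting_length[OF z(1)] C(1) by simp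
      ultimately show ?thesis using z(2) by linarith
    qed
    then have "expectation (\<lambda>\<omega>. global_max K g k (\<lambda>i. X i \<omega>) (\<lambda>j. Y j \<omega>)) \<le> expectation (\<lambda>\<omega>. C * real k)"
      using intG[of k 0] by (intro integral_mono) auto
    then show ?thesis using False by (simp add: a_def prob_space)
  qed (simp add: a_def)
  obtain l where l: "(\<lambda>k. a k / real k) \<longlonglongrightarrow> l" "\<And>k. 1 \<le> k \<Longrightarrow> a k / real k \<le> l"
    using superadditive_limit[of a C, OF super bound] by blast
  have chain: "(real B + 1) * (e - 2 * g (2 * n)) - 2 * g (2 * n) \<le> a (Suc B * n)" for B
  proof -
    let ?h = "\<lambda>\<omega> b. local_max K g n (\<lambda>i. X (b * n + i) \<omega>) (\<lambda>j. Y (b * n + j) \<omega>)"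
    have "(real B + 1) * (e - 2 * g (2 * n)) - 2 * g (2 * n)
      = (\<Sum>b\<le>B. expectation (\<lambda>\<omega>. ?h \<omega> b)) - (2 * real B + 4) * g (2 * n)"
      unfolding statL by (simp add: algebra_simps)
    also have "\<dots> = expectation (\<lambda>\<omega>. (\<Sum>b\<le>B. ?h \<omega> b) - (2 * real B + 4) * g (2 * n))"
      using intL by (simp add: prob_space)
    also have "\<dots> \<le> expectation (\<lambda>\<omega>. global_max K g (Suc B * n) (\<lambda>i. X i \<omega>) (\<lambda>j. Y j \<omega>))"
    proof (rule integral_mono)
      show "integrable M (\<lambda>\<omega>. (\<Sum>b\<le>B. ?h \<omega> b) - (2 * real B + 4) * g (2 * n))"
        using intL by auto
      show "integrable M (\<lambda>\<omega>. global_max K g (Suc B * n) (\<lambda>i. X i \<omega>) (\<lambda>j. Y j \<omega>))"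
        using intG[of "Suc B * n" 0] by simp
      fix \<omega>
      obtain z where z: "z \<in> fitting (Suc B * n)" "fst (hd z) \<le> n" "snd (hd z) \<le> n"
        "B * n \<le> fst (last z)" "B * n \<le> snd (last z)"
        "(\<Sum>b\<le>B. ?h \<omega> b) - 2 * real B * g (2 * n) \<le> score K g (\<lambda>i. X i \<omega>) (\<lambda>j. Y j \<omega>) z"
        using chain_blocks[OF g n, of B K "\<lambda>i. X i \<omega>" "\<lambda>j. Y j \<omega>"] by blast
      have "edge_cost g (Suc B * n) z \<le> g (2 * n) + g (2 * n) + g (2 * n) + g (2 * n)"
        unfolding edge_cost_def using z by (intro add_mono gap_penaltyD(3)[OF g]) auto
      then have "(\<Sum>b\<le>B. ?h \<omega> b) - (2 * real B + 4) * g (2 * n)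
        \<le> score K g (\<lambda>i. X i \<omega>) (\<lambda>j. Y j \<omega>) z - edge_cost g (Suc B * n) z"
        using z(6) by (simp add: algebra_simps)
      then show "(\<Sum>b\<le>B. ?h \<omega> b) - (2 * real B + 4) * g (2 * n)
        \<le> global_max K g (Suc B * n) (\<lambda>i. X i \<omega>) (\<lambda>j. Y j \<omega>)"
        using z(1) n by (subst global_max_ge_iff) auto
    qed
    also have "\<dots> = a (Suc B * n)" using n by (simp add: a_def)
    finally show ?thesis .
  qed
  have "0 < e - 2 * g (2 * n)" using gain by (simp add: e_def)
  then obtain B where "2 * g (2 * n) < real B * (e - 2 * g (2 * n))"
    using reals_Archimedean3 by blast
  then have "0 < a (Suc B * n)"
    using chain[of B] \<open>0 < e - 2 * g (2 * n)\<close> by (simp add: algebra_simps)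
  moreover have "0 < real (Suc B * n)" using n by (subst of_nat_0_less_iff) simp
  ultimately have "0 < a (Suc B * n) / real (Suc B * n)" by (rule divide_pos_pos)
  then have l0: "0 < l" using l(2)[of "Suc B * n"] n by (simp del: of_nat_Suc of_nat_mult mult_Suc)
  have "expectation (\<lambda>\<omega>. real_of_ereal (G_score K g (\<lambda>i. X i \<omega>) k (\<lambda>j. Y j \<omega>) k) / real k) = a k / real k"
    if "1 \<le> k" for k
    using that by (simp add: G_score_eq a_def)
  then have "(\<lambda>k. expectation (\<lambda>\<omega>. real_of_ereal (G_score K g (\<lambda>i. X i \<omega>) k (\<lambda>j. Y j \<omega>) k) / real k)) \<longlonglongrightarrow> l"
    using l(1) by (subst tendsto_cong[where g = "\<lambda>k. a k / real k"]) (auto intro: eventually_sequentiallyI[of 1])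
  then show ?thesis unfolding linear_domain_def using l0 by blast
qed

text \<open>Otherwise the series would be dominated by \<open>\<Sum>k. k powr (- s c)\<close>.\<close>
lemma frequently_small_gap:
  assumes div: "\<not> summable (\<lambda>k. exp (- s * \<gamma> (Suc k)))" and "1 < s * c" "0 < s"
  shows "\<exists>\<^sub>F k in sequentially. \<gamma> k \<le> c * ln (real k)"
proof (rule ccontr)
  assume "\<not> (\<exists>\<^sub>F k in sequentially. \<gamma> k \<le> c * ln (real k))"
  then have "\<forall>\<^sub>F k in sequentially. c * ln (real k) < \<gamma> k"
    by (simp add: not_frequently not_le)
  then have "\<forall>\<^sub>F k in sequentially. norm (exp (- s * \<gamma> k)) \<le> real k powr (- (s * c))"
    using eventually_gt_at_top[of 0]
  proof eventually_elim
    case (elim k)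
    have "- s * \<gamma> k \<le> - (s * c) * ln (real k)"
      using elim(1) \<open>0 < s\<close> by (simp add: mult.assoc)
    then show ?case using elim(2) by (simp add: powr_def)
  qed
  moreover have "summable (\<lambda>k. real k powr (- (s * c)))"
    using assms(2) by (simp add: summable_real_powr_iff)
  ultimately have "summable (\<lambda>k. exp (- s * \<gamma> k))"
    by (rule summable_comparison_test_ev)
  then show False using div summable_Suc_iff[of "\<lambda>k. exp (- s * \<gamma> k)"] by simp
qed

text \<open>The constants satisfy \<open>1/s < c < t/2 < 1/\<theta>\<close>: a block of length \<open>n\<close> gains almost \<open>t ln n\<close>, while the
  two gaps cost about \<open>2 c ln n\<close> for suitable \<open>n\<close>.\<close>
lemma linear_domain_gap:
  assumes g: "gap_penalty (gap \<Delta> \<gamma>)" and s: "\<theta> < s"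
    and div: "\<not> summable (\<lambda>k. exp (- s * \<gamma> (Suc k)))"
  shows "linear_domain M X Y K (gap \<Delta> \<gamma>)"
proof -
  let ?g = "gap \<Delta> \<gamma>"
  let ?L = "\<lambda>n \<omega>. local_max K ?g n (\<lambda>i. X i \<omega>) (\<lambda>j. Y j \<omega>)"
  have s0: "0 < s" using s theta_pos by linarith
  have "1 / s < 1 / \<theta>" using s theta_pos by (simp add: frac_less2)
  then obtain c where c: "1 / s < c" "c < 1 / \<theta>" using dense by blast
  have "0 < 1 / s" using s0 by simp
  then have "0 < c" using c by linarith
  then have c0: "0 < c" "1 < s * c" using c s0 by (auto simp: field_simps)
  have "2 * c < 2 / \<theta>" using c(2) by simp
  then obtain t where t: "2 * c < t" "t < 2 / \<theta>" using dense by blast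
  have t0: "0 < t" using t c0 by linarith
  \<comment> \<open>A failure probability that still leaves \<open>t (1 - \<epsilon>) > 2 c\<close>; the local score of a block is at
      least \<open>- C\<close> even when the block fails to reach \<open>t ln n\<close>.\<close>
  define \<epsilon> where "\<epsilon> = (t - 2 * c) / (2 * t)"
  have eps: "0 < \<epsilon>" using t t0 by (simp add: \<epsilon>_def)
  have "t * \<epsilon> = (t - 2 * c) / 2" using t0 by (simp add: \<epsilon>_def)
  then have D: "0 < t - t * \<epsilon> - 2 * c" using t by simp
  obtain C where C: "0 < C" "\<And>a b. \<bar>K a b\<bar> \<le> C" using K_bounded by blast
  have "\<forall>\<^sub>F n in sequentially. \<epsilon> * C + 2 * \<Delta> + 2 * c * ln 3 < (t - t * \<epsilon> - 2 * c) * ln (real n)"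
    using D by real_asymp
  moreover note local_max_large[where g = ?g, OF t0 t(2) gap_penaltyD(1)[OF g] eps]
  moreover have "\<forall>\<^sub>F n in sequentially. 1 < n" by (rule eventually_gt_at_top)
  ultimately have "\<forall>\<^sub>F n in sequentially. 1 < n \<and> 2 * (\<Delta> + c * ln (3 * real n)) < expectation (?L n)"
  proof eventually_elim
    case (elim n)
    then have n: "1 \<le> n" "0 < ln (real n)" by auto
    let ?b = "\<lambda>\<omega>. of_bool (?L n \<omega> < t * ln (real n)) :: real"
    have int: "integrable M (\<lambda>\<omega>. f (?L n \<omega>))" for f :: "real \<Rightarrow> real"
      by (rule integrable_local_max)
    have low: "expectation ?b \<le> \<epsilon>" using elim(2)[rule_format, of 0] by simp
    have "2 * (\<Delta> + c * ln (3 * real n)) = 2 * \<Delta> + 2 * c * ln 3 + 2 * c * ln (real n)"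
      using n by (simp add: ln_mult algebra_simps)
    also have "\<dots> < t * ln (real n) - (t * ln (real n) + C) * \<epsilon>"
      using elim(1) by (simp add: algebra_simps)
    also have "\<dots> \<le> t * ln (real n) - (t * ln (real n) + C) * expectation ?b"
      using low t0 n C(1) by (intro diff_left_mono mult_left_mono) auto
    also have "\<dots> = expectation (\<lambda>\<omega>. t * ln (real n) - (t * ln (real n) + C) * ?b \<omega>)"
      using int[of "\<lambda>h. of_bool (h < t * ln (real n))"] by (simp add: prob_space)
    also have "\<dots> \<le> expectation (?L n)"
    proof (rule integral_mono)
      show "integrable M (\<lambda>\<omega>. t * ln (real n) - (t * ln (real n) + C) * ?b \<omega>)"
        by (rule int[of "\<lambda>h. t * ln (real n) - (t * ln (real n) + C) * of_bool (h < t * ln (real n))"])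
      show "integrable M (?L n)" by (rule int)
      fix \<omega>
      have "- C \<le> score K ?g (\<lambda>i. X i \<omega>) (\<lambda>j. Y j \<omega>) [(1, 1)]"
        using C(2)[of "X 1 \<omega>" "Y 1 \<omega>"] by simp
      then have "- C \<le> ?L n \<omega>"
        unfolding local_max_ge_iff[OF n(1)] using fitting_nonempty[OF n(1)] by blast
      then show "t * ln (real n) - (t * ln (real n) + C) * ?b \<omega> \<le> ?L n \<omega>" by auto
    qed
    finally show ?case using elim(3) by simp
  qed
  then obtain n0 where n0: "\<And>n. n0 \<le> n \<Longrightarrow> 1 < n \<and> 2 * (\<Delta> + c * ln (3 * real n)) < expectation (?L n)"
    unfolding eventually_sequentially by blast
  obtain k where k: "2 * n0 + 2 \<le> k" "\<gamma> k \<le> c * ln (real k)"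
    using frequently_small_gap[OF div c0(2) s0] unfolding frequently_sequentially by blast
  define n where "n = k div 2"
  have n: "n0 \<le> n" "1 \<le> n" "2 * n \<le> k" "k \<le> 3 * n" using k(1) by (auto simp: n_def)
  have "?g (2 * n) \<le> ?g k" by (rule gap_penaltyD(3)[OF g n(3)])
  also have "\<dots> = \<Delta> + \<gamma> k" using k(1) by (simp add: gap_def)
  also have "\<dots> \<le> \<Delta> + c * ln (3 * real n)"
  proof -
    have "ln (real k) \<le> ln (3 * real n)" using n by (intro ln_mono) auto
    then have "c * ln (real k) \<le> c * ln (3 * real n)" using c0(1) by (intro mult_left_mono) auto
    then show ?thesis using k(2) by linarith
  qed
  finally have "2 * ?g (2 * n) \<le> 2 * (\<Delta> + c * ln (3 * real n))" by simp
  also have "\<dots> < expectation (?L n)" using n0[OF n(1)] by blast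
  finally show ?thesis by (rule linear_domainI[OF g n(2)])
qed

end

section \<open>The phase transition\<close>

lemma summable_log_gap_iff:
  assumes "\<And>k. 1 \<le> k \<Longrightarrow> \<gamma> k = \<delta> * ln (real k)"
  shows "summable (\<lambda>k. exp (- s * \<gamma> (Suc k))) \<longleftrightarrow> 1 < s * \<delta>"
proof -
  have "exp (- s * \<gamma> (Suc k)) = real (Suc k) powr (- (s * \<delta>))" for k
    using assms[of "Suc k"] by (simp add: powr_def)
  then have "summable (\<lambda>k. exp (- s * \<gamma> (Suc k))) \<longleftrightarrow> summable (\<lambda>k. real k powr (- (s * \<delta>)))"
    using summable_Suc_iff[of "\<lambda>k. real k powr (- (s * \<delta>))"] by presburger
  then show ?thesis by (simp add: summable_real_powr_iff)
qed

theorem theorem1: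
  fixes M :: "'w measure"
    and X Y :: "nat \<Rightarrow> 'w \<Rightarrow> 'a::finite"
    and \<mu> :: "'a pmf"
    and K :: "'a \<Rightarrow> 'a \<Rightarrow> real"
    and \<gamma> :: "nat \<Rightarrow> real"
  assumes "prob_space M"
    and "iid_letters M X Y \<mu>"
    and "\<And>a. 0 < pmf \<mu> a"
    and "\<And>a b. K a b = K b a"
    and "(\<integral>\<omega>. K (X 1 \<omega>) (Y 1 \<omega>) \<partial>M) < 0"
    and "0 < Max (range (\<lambda>(a, b). K a b))"
    and "\<gamma> 1 = 0"
    and "\<And>k. 1 \<le> k \<Longrightarrow> 0 \<le> \<gamma> k"
  shows
    "((\<exists>\<theta><theta_star M X Y K. summable (\<lambda>k. exp (- \<theta> * \<gamma> (Suc k)))) \<longrightarrow>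
        (\<exists>\<Delta>\<^sub>0. \<forall>\<Delta>\<ge>\<Delta>\<^sub>0. gap_penalty (gap \<Delta> \<gamma>) \<longrightarrow> logarithmic_domain M X Y K (gap \<Delta> \<gamma>))) \<and>
     ((\<exists>\<theta>>theta_star M X Y K. \<not> summable (\<lambda>k. exp (- \<theta> * \<gamma> (Suc k)))) \<longrightarrow>
        (\<forall>\<Delta>. gap_penalty (gap \<Delta> \<gamma>) \<longrightarrow> linear_domain M X Y K (gap \<Delta> \<gamma>))) \<and>
     (\<forall>\<delta>>0. (\<forall>k\<ge>1. \<gamma> k = \<delta> * ln (real k)) \<longrightarrow>
        (\<delta> > inverse (theta_star M X Y K) \<longrightarrow>
          (\<exists>\<Delta>\<^sub>0. \<forall>\<Delta>\<ge>\<Delta>\<^sub>0. gap_penalty (gap \<Delta> \<gamma>) \<longrightarrow> logarithmic_domain M X Y K (gap \<Delta> \<gamma>))) \<and>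
        (\<delta> < inverse (theta_star M X Y K) \<longrightarrow>
          (\<forall>\<Delta>. gap_penalty (gap \<Delta> \<gamma>) \<longrightarrow> linear_domain M X Y K (gap \<Delta> \<gamma>))))"
proof -
  interpret iid_words M X Y \<mu>
    using assms(1,2) by (intro iid_words.intro iid_words_axioms.intro)
  have max: "\<exists>a b. 0 < K a b"
  proof -
    have "Max (range (\<lambda>(a, b). K a b)) \<in> range (\<lambda>(a, b). K a b)" by (rule Max_in) auto
    then obtain z where "Max (range (\<lambda>(a, b). K a b)) = (\<lambda>(a, b). K a b) z" by (rule rangeE)
    then have "0 < (\<lambda>(a, b). K a b) z" using assms(6) by simp
    then show ?thesis by (cases z) auto
  qed
  have "mean (pair_pmf \<mu> \<mu>) (\<lambda>z. K (fst z) (snd z)) < 0"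
    using assms(5) unfolding expectation_first_letters .
  then interpret score_words \<mu> K M X Y
    by unfold_locales (use assms(3,4) max in simp_all)
  have theta: "theta_star M X Y K = \<theta>"
    unfolding theta_star_def \<theta>_def mgf_def
    by (simp only: expectation_first_letters[of "\<lambda>a b. exp (_ * K a b)"])
  have log: "\<exists>\<Delta>\<^sub>0. \<forall>\<Delta>\<ge>\<Delta>\<^sub>0. gap_penalty (gap \<Delta> \<gamma>) \<longrightarrow> logarithmic_domain M X Y K (gap \<Delta> \<gamma>)"
    if "s < \<theta>" "summable (\<lambda>k. exp (- s * \<gamma> (Suc k)))" for s
    using logarithmic_domain_gap[OF assms(8) that] by blast
  have lin: "\<forall>\<Delta>. gap_penalty (gap \<Delta> \<gamma>) \<longrightarrow> linear_domain M X Y K (gap \<Delta> \<gamma>)"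
    if "\<theta> < s" "\<not> summable (\<lambda>k. exp (- s * \<gamma> (Suc k)))" for s
    using linear_domain_gap[OF _ that] by blast
  show ?thesis unfolding theta
  proof (intro conjI impI allI)
    assume "\<exists>s<\<theta>. summable (\<lambda>k. exp (- s * \<gamma> (Suc k)))"
    then show "\<exists>\<Delta>\<^sub>0. \<forall>\<Delta>\<ge>\<Delta>\<^sub>0. gap_penalty (gap \<Delta> \<gamma>) \<longrightarrow> logarithmic_domain M X Y K (gap \<Delta> \<gamma>)"
      using log by blast
  next
    fix \<Delta> assume "\<exists>s>\<theta>. \<not> summable (\<lambda>k. exp (- s * \<gamma> (Suc k)))" "gap_penalty (gap \<Delta> \<gamma>)"
    then show "linear_domain M X Y K (gap \<Delta> \<gamma>)" using lin by blast
  next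
    fix \<delta> :: real
    assume \<delta>: "0 < \<delta>" "\<forall>k\<ge>1. \<gamma> k = \<delta> * ln (real k)"
    note iff = summable_log_gap_iff[of \<gamma> \<delta>, OF \<delta>(2)[rule_format]]
    show "\<exists>\<Delta>\<^sub>0. \<forall>\<Delta>\<ge>\<Delta>\<^sub>0. gap_penalty (gap \<Delta> \<gamma>) \<longrightarrow> logarithmic_domain M X Y K (gap \<Delta> \<gamma>)"
      if "inverse \<theta> < \<delta>"
    proof -
      have "1 / \<delta> < \<theta>" using that \<delta>(1) theta_pos by (simp add: field_simps)
      then obtain s where s: "1 / \<delta> < s" "s < \<theta>" using dense by blast
      then have "1 < s * \<delta>" using \<delta>(1) by (simp add: field_simps)
      then show ?thesis using log[OF s(2)] iff[of s] by blast
    qed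
    show "linear_domain M X Y K (gap \<Delta> \<gamma>)" if "\<delta> < inverse \<theta>" "gap_penalty (gap \<Delta> \<gamma>)" for \<Delta>
    proof -
      have "\<theta> < 1 / \<delta>" using that \<delta>(1) theta_pos by (simp add: field_simps)
      moreover have "\<not> summable (\<lambda>k. exp (- (1 / \<delta>) * \<gamma> (Suc k)))" using iff[of "1 / \<delta>"] \<delta>(1) by simp
      ultimately show ?thesis using lin that(2) by blast
    qed
  qed
qed

end
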